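(* Let $p$ be an odd prime and $D_{2p}=\langle \tau,\sigma\mid \tau^p=\sigma^2=e,\ \sigma\tau\sigma=\tau^{-1}\rangle$. The number of connected Cayley graphs on $D_{2p}$ up to isomorphism is $\mathcal{N}_1'=\mathcal{N}'-\mathcal{N}_c'-1$, where $$\mathcal{N}'=\frac{1}{p}\left(2^{\frac{p+1}{2}}-2^{\frac{3p-1}{2}}\right)+\frac{2}{p-1}\sum_{i=0}^{p-2}2^{\frac{\gcd(2i,p-1)}{2}+\gcd(i,p-1)},\qquad \mathcal{N}_c'=\frac{2}{p-1}\sum_{d\mid\frac{p-1}{2}}\Phi(d)\,2^{\frac{p-1}{2d}},$$ and $\Phi$ is Euler's totient function.
   Context: For a finite group $G$ and $S\subseteq G$ with $e\notin S$ and $S^{-1}=S$, the Cayley graph $\mathrm{Cay}(G,S)$ is the undirected graph with vertex set $G$ in which $g,h$ are adjacent whenever $hg^{-1}\in S$; it is connected iff $\langle S\rangle=G$. Here $\gcd(0,p-1)=p-1$. *)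

theory Defs
  imports
    "HOL-Algebra.Generated_Groups"
    "HOL-Number_Theory.Totient"
    "Graph_Theory.Digraph_Isomorphism"
begin

section \<open>Dihedral groups\<close>

text \<open>
  The dihedral group of order \<open>2n\<close>, in normal form: the pair \<open>(a, s)\<close> with \<open>0 \<le> a < n\<close>
  stands for \<open>\<tau>\<^sup>a\<sigma>\<^sup>s\<close>, and the product comes from \<open>\<sigma>\<tau>\<^sup>b = \<tau>\<^sup>-\<^sup>b\<sigma>\<close>.
  The lemmas \<open>dihedral_relations\<close>, \<open>dihedral_generate\<close> and \<open>dihedral_universal\<close> show that this is
  the group presented by \<open>\<langle>\<tau>, \<sigma> | \<tau>\<^sup>n = \<sigma>\<^sup>2 = e, \<sigma>\<tau>\<sigma> = \<tau>\<^sup>-\<^sup>1\<rangle>\<close>.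
\<close>

definition dihedral_group :: "nat \<Rightarrow> (int \<times> bool) monoid" where
  "dihedral_group n =
    \<lparr>carrier = {0..<int n} \<times> UNIV,
     monoid.mult = (\<lambda>(a, s) (b, t). ((if s then a - b else a + b) mod int n, s \<noteq> t)),
     one = (0, False)\<rparr>"

definition dihedral_tau :: "nat \<Rightarrow> int \<times> bool" where
  "dihedral_tau n = (1 mod int n, False)"

definition dihedral_sigma :: "int \<times> bool" where
  "dihedral_sigma = (0, True)"

lemma group_dihedral_group:
  assumes "n > 0"
  shows "group (dihedral_group n)"
proof (rule groupI)
  fix x y z
  assume "x \<in> carrier (dihedral_group n)" "y \<in> carrier (dihedral_group n)"
    "z \<in> carrier (dihedral_group n)"
  then show "x \<otimes>\<^bsub>dihedral_group n\<^esub> y \<otimes>\<^bsub>dihedral_group n\<^esub> z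
      = x \<otimes>\<^bsub>dihedral_group n\<^esub> (y \<otimes>\<^bsub>dihedral_group n\<^esub> z)"
    by (cases x; cases y; cases z) (auto simp: dihedral_group_def mod_simps algebra_simps)
next
  fix x assume x: "x \<in> carrier (dihedral_group n)"
  obtain a s where [simp]: "x = (a, s)" by (cases x)
  show "\<exists>y\<in>carrier (dihedral_group n). y \<otimes>\<^bsub>dihedral_group n\<^esub> x = \<one>\<^bsub>dihedral_group n\<^esub>"
    using x assms
    by (intro bexI[of _ "(if s then a else (- a) mod int n, s)"])
       (auto simp: dihedral_group_def mod_simps)
qed (use assms in \<open>auto simp: dihedral_group_def\<close>)

lemma order_dihedral_group: "order (dihedral_group n) = 2 * n"
  by (simp add: order_def dihedral_group_def card_cartesian_product)

lemma dihedral_tau_pow: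
  "dihedral_tau n [^]\<^bsub>dihedral_group n\<^esub> (k::nat) = (int k mod int n, False)"
  by (induction k) (auto simp: dihedral_group_def dihedral_tau_def nat_pow_def mod_simps add.commute)

lemma dihedral_relations:
  assumes "n > 0"
  defines "D \<equiv> dihedral_group n"
  shows "dihedral_tau n \<in> carrier D" "dihedral_sigma \<in> carrier D"
    and "dihedral_tau n [^]\<^bsub>D\<^esub> n = \<one>\<^bsub>D\<^esub>"
    and "dihedral_sigma [^]\<^bsub>D\<^esub> (2::nat) = \<one>\<^bsub>D\<^esub>"
    and "dihedral_sigma \<otimes>\<^bsub>D\<^esub> dihedral_tau n \<otimes>\<^bsub>D\<^esub> dihedral_sigma = inv\<^bsub>D\<^esub> (dihedral_tau n)"
proof -
  interpret group D unfolding D_def by (rule group_dihedral_group[OF assms(1)])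
  show t: "dihedral_tau n \<in> carrier D" and s: "dihedral_sigma \<in> carrier D"
    using assms by (auto simp: D_def dihedral_group_def dihedral_tau_def dihedral_sigma_def)
  show "dihedral_tau n [^]\<^bsub>D\<^esub> n = \<one>\<^bsub>D\<^esub>"
    unfolding D_def dihedral_tau_pow by (simp add: dihedral_group_def)
  show "dihedral_sigma [^]\<^bsub>D\<^esub> (2::nat) = \<one>\<^bsub>D\<^esub>"
    by (simp add: D_def dihedral_group_def dihedral_sigma_def numeral_2_eq_2)
  have "(dihedral_sigma \<otimes>\<^bsub>D\<^esub> dihedral_tau n \<otimes>\<^bsub>D\<^esub> dihedral_sigma) \<otimes>\<^bsub>D\<^esub> dihedral_tau n = \<one>\<^bsub>D\<^esub>"
    by (simp add: D_def dihedral_group_def dihedral_tau_def dihedral_sigma_def mod_simps)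
  then show "dihedral_sigma \<otimes>\<^bsub>D\<^esub> dihedral_tau n \<otimes>\<^bsub>D\<^esub> dihedral_sigma = inv\<^bsub>D\<^esub> (dihedral_tau n)"
    using inv_equality s t by (metis m_closed)
qed

lemma dihedral_normal_form:
  assumes "(a, s) \<in> carrier (dihedral_group n)"
  shows "(a, s) = dihedral_tau n [^]\<^bsub>dihedral_group n\<^esub> nat a
    \<otimes>\<^bsub>dihedral_group n\<^esub> (if s then dihedral_sigma else \<one>\<^bsub>dihedral_group n\<^esub>)"
  using assms unfolding dihedral_tau_pow
  by (auto simp: dihedral_group_def dihedral_sigma_def)

lemma dihedral_generate:
  assumes "n > 0"
  shows "generate (dihedral_group n) {dihedral_tau n, dihedral_sigma} = carrier (dihedral_group n)"
proof -
  interpret group "dihedral_group n" by (rule group_dihedral_group[OF assms])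
  let ?X = "generate (dihedral_group n) {dihedral_tau n, dihedral_sigma}"
  have sub: "subgroup ?X (dihedral_group n)"
    using dihedral_relations(1,2)[OF assms] by (intro generate_is_subgroup) auto
  have "dihedral_tau n [^]\<^bsub>dihedral_group n\<^esub> (k::nat) \<in> ?X" for k
    by (induction k) (auto intro: generate.intros)
  then have "(a, s) \<in> ?X" if "(a, s) \<in> carrier (dihedral_group n)" for a s
    by (subst dihedral_normal_form[OF that]) (auto intro: generate.intros)
  with subgroup.subset[OF sub] show ?thesis by auto
qed

lemma dihedral_universal:
  fixes H :: "('a, 'b) monoid_scheme"
  assumes n: "n > 0" and H: "group H"
    and x: "x \<in> carrier H" and y: "y \<in> carrier H"
    and xn: "x [^]\<^bsub>H\<^esub> n = \<one>\<^bsub>H\<^esub>" and y2: "y [^]\<^bsub>H\<^esub> (2::nat) = \<one>\<^bsub>H\<^esub>"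
    and yxy: "y \<otimes>\<^bsub>H\<^esub> x \<otimes>\<^bsub>H\<^esub> y = inv\<^bsub>H\<^esub> x"
  shows "\<exists>f \<in> hom (dihedral_group n) H. f (dihedral_tau n) = x \<and> f dihedral_sigma = y"
proof -
  interpret group H by (rule H)
  have per: "x [^]\<^bsub>H\<^esub> (k mod int n) = x [^]\<^bsub>H\<^esub> k" for k :: int
  proof -
    have "x [^]\<^bsub>H\<^esub> k = x [^]\<^bsub>H\<^esub> (int n * (k div int n) + k mod int n)" by simp
    also have "\<dots> = (x [^]\<^bsub>H\<^esub> int n) [^]\<^bsub>H\<^esub> (k div int n) \<otimes>\<^bsub>H\<^esub> x [^]\<^bsub>H\<^esub> (k mod int n)"
      using x by (simp only: int_pow_mult int_pow_pow)
    finally show ?thesis using x xn by (simp add: int_pow_int)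
  qed
  have yy: "y \<otimes>\<^bsub>H\<^esub> y = \<one>\<^bsub>H\<^esub>" using y2 y by (simp add: numeral_2_eq_2)
  have yx: "y \<otimes>\<^bsub>H\<^esub> x = inv\<^bsub>H\<^esub> x \<otimes>\<^bsub>H\<^esub> y"
    using yxy yy x y by (metis m_assoc m_closed r_one)
  have yxi: "y \<otimes>\<^bsub>H\<^esub> inv\<^bsub>H\<^esub> x = x \<otimes>\<^bsub>H\<^esub> y"
    using yxy yy x y by (metis inv_closed inv_equality inv_inv inv_mult_group m_assoc m_closed r_one)
  have comm_nat: "y \<otimes>\<^bsub>H\<^esub> z [^]\<^bsub>H\<^esub> (k::nat) = (inv\<^bsub>H\<^esub> z) [^]\<^bsub>H\<^esub> k \<otimes>\<^bsub>H\<^esub> y"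
    if "z \<in> carrier H" "y \<otimes>\<^bsub>H\<^esub> z = inv\<^bsub>H\<^esub> z \<otimes>\<^bsub>H\<^esub> y" for z k
    by (induction k) (use that y in \<open>simp_all add: m_assoc[symmetric], simp add: m_assoc\<close>)
  have comm: "y \<otimes>\<^bsub>H\<^esub> x [^]\<^bsub>H\<^esub> k = x [^]\<^bsub>H\<^esub> (- k) \<otimes>\<^bsub>H\<^esub> y" for k :: int
  proof (cases k)
    case (nonneg m)
    then show ?thesis using comm_nat[OF x yx, of m] x
      by (simp add: int_pow_int int_pow_neg nat_pow_inv)
  next
    case (neg m)
    then show ?thesis using comm_nat[of "inv\<^bsub>H\<^esub> x" "Suc m"] x yxi
      by (simp only: int_pow_neg int_pow_int nat_pow_inv minus_minus inv_closed inv_inv)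
  qed
  define f where "f = (\<lambda>(a::int, s). x [^]\<^bsub>H\<^esub> a \<otimes>\<^bsub>H\<^esub> (if s then y else \<one>\<^bsub>H\<^esub>))"
  have "f ((a, s) \<otimes>\<^bsub>dihedral_group n\<^esub> (b, t)) = f (a, s) \<otimes>\<^bsub>H\<^esub> f (b, t)" for a b s t
  proof (cases s)
    case True
    have "x [^]\<^bsub>H\<^esub> a \<otimes>\<^bsub>H\<^esub> y \<otimes>\<^bsub>H\<^esub> (x [^]\<^bsub>H\<^esub> b \<otimes>\<^bsub>H\<^esub> z)
        = x [^]\<^bsub>H\<^esub> (a - b) \<otimes>\<^bsub>H\<^esub> (y \<otimes>\<^bsub>H\<^esub> z)" if "z \<in> carrier H" for z
    proof -
      have "x [^]\<^bsub>H\<^esub> a \<otimes>\<^bsub>H\<^esub> y \<otimes>\<^bsub>H\<^esub> (x [^]\<^bsub>H\<^esub> b \<otimes>\<^bsub>H\<^esub> z)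
          = x [^]\<^bsub>H\<^esub> a \<otimes>\<^bsub>H\<^esub> (y \<otimes>\<^bsub>H\<^esub> x [^]\<^bsub>H\<^esub> b) \<otimes>\<^bsub>H\<^esub> z"
        using x y that by (simp add: m_assoc)
      also have "\<dots> = (x [^]\<^bsub>H\<^esub> a \<otimes>\<^bsub>H\<^esub> x [^]\<^bsub>H\<^esub> (- b)) \<otimes>\<^bsub>H\<^esub> (y \<otimes>\<^bsub>H\<^esub> z)"
        unfolding comm using x y that by (simp add: m_assoc)
      also have "x [^]\<^bsub>H\<^esub> a \<otimes>\<^bsub>H\<^esub> x [^]\<^bsub>H\<^esub> (- b) = x [^]\<^bsub>H\<^esub> (a - b)"
        using x by (simp add: int_pow_mult[symmetric])
      finally show ?thesis .
    qed
    with True x y yy show ?thesis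
      by (auto simp: f_def dihedral_group_def per)
  next
    case False
    with x y show ?thesis
      by (auto simp: f_def dihedral_group_def per int_pow_mult m_assoc)
  qed
  moreover have "f (a, s) \<in> carrier H" for a s
    using x y by (simp add: f_def)
  ultimately have "f \<in> hom (dihedral_group n) H"
    by (auto intro!: homI)
  moreover have "f (dihedral_tau n) = x" "f dihedral_sigma = y"
    using x y by (auto simp: f_def dihedral_tau_def dihedral_sigma_def per)
  ultimately show ?thesis by blast
qed


section \<open>Cayley graphs\<close>

definition cayley_set :: "('a, 'b) monoid_scheme \<Rightarrow> 'a set \<Rightarrow> bool" where
  "cayley_set G S \<longleftrightarrow> S \<subseteq> carrier G \<and> \<one>\<^bsub>G\<^esub> \<notin> S \<and> m_inv G ` S = S"

text \<open>As usual in the digraph library, an undirected edge is a pair of opposite arcs.\<close>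

definition cayley_graph :: "('a, 'b) monoid_scheme \<Rightarrow> 'a set \<Rightarrow> 'a pair_pre_digraph" where
  "cayley_graph G S =
    \<lparr>pverts = carrier G,
     parcs = {(g, h). g \<in> carrier G \<and> h \<in> carrier G \<and> h \<otimes>\<^bsub>G\<^esub> inv\<^bsub>G\<^esub> g \<in> S}\<rparr>"

definition connected_cayley_graphs ::
    "('a, 'b) monoid_scheme \<Rightarrow> ('a, 'a \<times> 'a) pre_digraph set" where
  "connected_cayley_graphs G =
    {with_proj (cayley_graph G S) | S.
      cayley_set G S \<and> Digraph_Component.connected (with_proj (cayley_graph G S))}"

definition digraph_iso_on ::
    "('a, 'b) pre_digraph set \<Rightarrow> (('a, 'b) pre_digraph \<times> ('a, 'b) pre_digraph) set" where
  "digraph_iso_on \<G> = {(X, Y). X \<in> \<G> \<and> Y \<in> \<G> \<and> digraph_iso X Y}"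

definition num_up_to_iso :: "('a, 'b) pre_digraph set \<Rightarrow> nat" where
  "num_up_to_iso \<G> = card (\<G> // digraph_iso_on \<G>)"

lemma pair_graph_cayley_graph:
  assumes "group G" "finite (carrier G)" "cayley_set G S"
  shows "pair_graph (cayley_graph G S)"
proof -
  interpret group G by fact
  have "h \<otimes>\<^bsub>G\<^esub> inv\<^bsub>G\<^esub> g \<in> S \<Longrightarrow> g \<otimes>\<^bsub>G\<^esub> inv\<^bsub>G\<^esub> h \<in> S"
    if "g \<in> carrier G" "h \<in> carrier G" for g h
  proof -
    assume "h \<otimes>\<^bsub>G\<^esub> inv\<^bsub>G\<^esub> g \<in> S"
    then have "inv\<^bsub>G\<^esub> (h \<otimes>\<^bsub>G\<^esub> inv\<^bsub>G\<^esub> g) \<in> S"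
      using assms(3) by (auto simp: cayley_set_def)
    with that show ?thesis by (simp add: inv_mult_group)
  qed
  then have sym: "sym (parcs (cayley_graph G S))"
    by (auto simp: cayley_graph_def sym_def)
  have "finite (parcs (cayley_graph G S))"
    by (rule finite_subset[of _ "carrier G \<times> carrier G"])
       (use assms in \<open>auto simp: cayley_graph_def\<close>)
  with assms sym show ?thesis
    by unfold_locales (auto simp: cayley_graph_def cayley_set_def symmetric_def)
qed

text \<open>On graphs without parallel arcs, the library's isomorphism is the usual one.\<close>

lemma digraph_iso_with_proj_iff:
  assumes "pair_wf_digraph X" "pair_wf_digraph Y"
  shows "digraph_iso (with_proj X) (with_proj Y) \<longleftrightarrow>
    (\<exists>f. bij_betw f (pverts X) (pverts Y) \<and>
      (\<forall>u\<in>pverts X. \<forall>v\<in>pverts X. (u, v) \<in> parcs X \<longleftrightarrow> (f u, f v) \<in> parcs Y))"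
    (is "?L \<longleftrightarrow> ?R")
proof
  interpret X: pair_wf_digraph X by fact
  assume ?L
  then obtain h where h: "pre_digraph.digraph_isomorphism (with_proj X) h"
      and Y: "with_proj Y = app_iso h (with_proj X)"
    by (auto simp: digraph_iso_def)
  have V: "pverts Y = iso_verts h ` pverts X" and A: "parcs Y = iso_arcs h ` parcs X"
    and T: "iso_tail h = fst" and H: "iso_head h = snd"
    using arg_cong[OF Y, of verts] arg_cong[OF Y, of arcs]
      arg_cong[OF Y, of tail] arg_cong[OF Y, of head] by simp_all
  have inj: "inj_on (iso_verts h) (pverts X)"
    and arcs: "\<And>u v. (u, v) \<in> parcs X \<Longrightarrow> iso_arcs h (u, v) = (iso_verts h u, iso_verts h v)"
    using h T H by (auto simp: pre_digraph.digraph_isomorphism_def prod_eq_iff)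
  show ?R
  proof (intro exI[of _ "iso_verts h"] conjI ballI)
    show "bij_betw (iso_verts h) (pverts X) (pverts Y)"
      using inj V by (auto simp: bij_betw_def)
    fix u v assume uv: "u \<in> pverts X" "v \<in> pverts X"
    show "(u, v) \<in> parcs X \<longleftrightarrow> (iso_verts h u, iso_verts h v) \<in> parcs Y"
    proof
      assume "(u, v) \<in> parcs X"
      then show "(iso_verts h u, iso_verts h v) \<in> parcs Y"
        using arcs A by (metis imageI)
    next
      assume "(iso_verts h u, iso_verts h v) \<in> parcs Y"
      then obtain a b where ab: "(a, b) \<in> parcs X"
          "(iso_verts h u, iso_verts h v) = iso_arcs h (a, b)"
        unfolding A by auto
      moreover have "a \<in> pverts X" "b \<in> pverts X"
        using ab X.in_arcsD1 X.in_arcsD2 by auto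
      ultimately have "u = a" "v = b"
        using arcs[OF ab(1)] inj uv by (auto simp: inj_on_def)
      with ab(1) show "(u, v) \<in> parcs X" by simp
    qed
  qed
next
  interpret X: pair_wf_digraph X by fact
  interpret Y: pair_wf_digraph Y by fact
  assume ?R
  then obtain f where bij: "bij_betw f (pverts X) (pverts Y)"
    and adj: "\<And>u v. u \<in> pverts X \<Longrightarrow> v \<in> pverts X \<Longrightarrow>
      (u, v) \<in> parcs X \<longleftrightarrow> (f u, f v) \<in> parcs Y"
    by blast
  define h where "h = \<lparr>iso_verts = f, iso_arcs = map_prod f f, iso_head = snd, iso_tail = fst\<rparr>"
  have inj: "inj_on f (pverts X)" and img: "f ` pverts X = pverts Y"
    using bij by (auto simp: bij_betw_def)
  have "parcs X \<subseteq> pverts X \<times> pverts X"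
    using X.in_arcsD1 X.in_arcsD2 by auto
  then have "inj_on (map_prod f f) (parcs X)"
    using map_prod_inj_on[OF inj inj] inj_on_subset by blast
  then have "pre_digraph.digraph_isomorphism (with_proj X) h"
    using inj X.wf_digraph by (auto simp: pre_digraph.digraph_isomorphism_def h_def)
  moreover have "map_prod f f ` parcs X = parcs Y"
  proof (intro equalityI subsetI)
    fix e assume "e \<in> map_prod f f ` parcs X"
    then obtain u v where uv: "(u, v) \<in> parcs X" "e = (f u, f v)" by auto
    then show "e \<in> parcs Y"
      using adj[OF X.in_arcsD1[OF uv(1)] X.in_arcsD2[OF uv(1)]] by simp
  next
    fix e assume e: "e \<in> parcs Y"
    then have "fst e \<in> f ` pverts X" "snd e \<in> f ` pverts X"
      using Y.in_arcsD1[of "fst e" "snd e"] Y.in_arcsD2[of "fst e" "snd e"] img by auto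
    then obtain u v where uv: "u \<in> pverts X" "v \<in> pverts X" "e = (f u, f v)"
      by (metis imageE prod.collapse)
    with adj[of u v] e have "(u, v) \<in> parcs X" by simp
    with uv(3) show "e \<in> map_prod f f ` parcs X" by (auto intro: image_eqI[of _ _ "(u, v)"])
  qed
  then have "with_proj Y = app_iso h (with_proj X)"
    using img by (simp add: with_proj_def app_iso_def h_def)
  ultimately show ?L by (auto simp: digraph_iso_def)
qed

lemma equiv_digraph_iso_on:
  assumes "\<And>X. X \<in> \<G> \<Longrightarrow> \<exists>P. X = with_proj P \<and> pair_wf_digraph P"
  shows "equiv \<G> (digraph_iso_on \<G>)"
proof (rule equivI)
  show "digraph_iso_on \<G> \<subseteq> \<G> \<times> \<G>"
    by (auto simp: digraph_iso_on_def)
  show "refl_on \<G> (digraph_iso_on \<G>)"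
  proof (rule refl_onI)
    fix X assume X: "X \<in> \<G>"
    then obtain P where "X = with_proj P" "pair_wf_digraph P" using assms by blast
    then have "digraph_iso X X"
      by (auto simp: digraph_iso_with_proj_iff intro: exI[of _ id])
    with X show "(X, X) \<in> digraph_iso_on \<G>" by (simp add: digraph_iso_on_def)
  qed
  show "sym (digraph_iso_on \<G>)"
  proof (rule symI)
    fix X Y assume XY: "(X, Y) \<in> digraph_iso_on \<G>"
    then obtain P Q where P: "X = with_proj P" "pair_wf_digraph P"
        and Q: "Y = with_proj Q" "pair_wf_digraph Q"
      using assms by (auto simp: digraph_iso_on_def) metis
    then obtain f where f: "bij_betw f (pverts P) (pverts Q)"
      and adj: "\<forall>u\<in>pverts P. \<forall>v\<in>pverts P. (u, v) \<in> parcs P \<longleftrightarrow> (f u, f v) \<in> parcs Q"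
      using XY by (auto simp: digraph_iso_on_def digraph_iso_with_proj_iff)
    have "(inv_into (pverts P) f u, inv_into (pverts P) f v) \<in> parcs P \<longleftrightarrow> (u, v) \<in> parcs Q"
      if "u \<in> pverts Q" "v \<in> pverts Q" for u v
    proof -
      have "inv_into (pverts P) f u \<in> pverts P" "inv_into (pverts P) f v \<in> pverts P"
        using bij_betwE[OF bij_betw_inv_into[OF f]] that by auto
      with adj show ?thesis
        using bij_betw_inv_into_right[OF f] that by simp
    qed
    with bij_betw_inv_into[OF f] P Q have "digraph_iso Y X"
      by (auto simp: digraph_iso_with_proj_iff)
    with XY show "(Y, X) \<in> digraph_iso_on \<G>" by (simp add: digraph_iso_on_def)
  qed
  show "trans (digraph_iso_on \<G>)"
  proof (rule transI)
    fix X Y Z assume XY: "(X, Y) \<in> digraph_iso_on \<G>" and YZ: "(Y, Z) \<in> digraph_iso_on \<G>"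
    then obtain P Q R where P: "X = with_proj P" "pair_wf_digraph P"
        and Q: "Y = with_proj Q" "pair_wf_digraph Q"
        and R: "Z = with_proj R" "pair_wf_digraph R"
      using assms by (auto simp: digraph_iso_on_def) metis
    then obtain f g where f: "bij_betw f (pverts P) (pverts Q)"
      and adjf: "\<forall>u\<in>pverts P. \<forall>v\<in>pverts P. (u, v) \<in> parcs P \<longleftrightarrow> (f u, f v) \<in> parcs Q"
      and g: "bij_betw g (pverts Q) (pverts R)"
      and adjg: "\<forall>u\<in>pverts Q. \<forall>v\<in>pverts Q. (u, v) \<in> parcs Q \<longleftrightarrow> (g u, g v) \<in> parcs R"
      using XY YZ by (auto simp: digraph_iso_on_def digraph_iso_with_proj_iff)
    have "\<forall>u\<in>pverts P. \<forall>v\<in>pverts P. (u, v) \<in> parcs P \<longleftrightarrow> ((g \<circ> f) u, (g \<circ> f) v) \<in> parcs R"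
      using adjf adjg bij_betwE[OF f] by simp
    with bij_betw_trans[OF f g] P R have "digraph_iso X Z"
      by (auto simp: digraph_iso_with_proj_iff)
    with XY YZ show "(X, Z) \<in> digraph_iso_on \<G>" by (simp add: digraph_iso_on_def)
  qed
qed

end

theory Submission
  imports
    Defs
    "HOL-Algebra.Sylow"
    "HOL-Algebra.Group_Action"
    "HOL-Number_Theory.Residue_Primitive_Roots"
begin

text \<open>
  Let \<open>\<rho>\<close> be right multiplication by \<open>\<tau>\<close>, an automorphism of every Cayley graph. Given an isomorphism
  \<open>f\<close> between two of them, both \<open>\<rho>\<close> and \<open>f\<^sup>-\<^sup>1\<rho>f\<close> are automorphisms of order \<open>p\<close> of the first, so after
  composing \<open>f\<close> with an automorphism they lie in a common Sylow \<open>p\<close>-subgroup. On \<open>2p\<close> points, \<open>p\<close> odd,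
  such a subgroup preserves the two orbits of \<open>\<rho>\<close> and acts on each by translations. Hence \<open>f\<close> is affine on
  each orbit, and the two connection sets differ by a group automorphism
  \<open>\<tau>\<^sup>a \<mapsto> \<tau>\<^sup>u\<^sup>a\<close>, \<open>\<tau>\<^sup>a\<sigma> \<mapsto> \<tau>\<^sup>u\<^sup>a\<^sup>+\<^sup>v\<sigma>\<close>.

  Isomorphism classes are therefore orbits of the affine group on pairs \<open>(A, B)\<close> with
  \<open>A = -A \<subseteq> \<int>\<^sub>p - {0}\<close> and \<open>B \<subseteq> \<int>\<^sub>p\<close>, where connectedness excludes exactly \<open>B = {}\<close> and
  \<open>A = {}, |B| = 1\<close>. Burnside's lemma counts them: taking logarithms to a primitive root \<open>g\<close>, the sets
  invariant under \<open>u = g\<^sup>i\<close> become periodic sets of exponents, with period \<open>gcd i ((p - 1)/2)\<close> for \<open>A\<close>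
  and \<open>gcd i (p - 1)\<close> for \<open>B\<close>.
\<close>

section \<open>Permutations of prime power order and Sylow subgroups\<close>

text \<open>The three terms of the formula have separate origins. \<open>N'\<close> is the orbit
  count for all pairs \<open>(A, B)\<close>; \<open>Nc'\<close> is the count for
  \<open>B = {}\<close>, that is, of two-coloured necklaces with \<open>m = (p - 1)/2\<close> beads,
  since a primitive root permutes the \<open>m\<close> classes \<open>{a, -a}\<close> cyclically;
  the 1 is the orbit with \<open>A = {}\<close> and \<open>B\<close> a singleton, the perfect
  matching. The last two are subtracted inside each fixed-point count, not afterwards.

  For \<open>u \<noteq> 1\<close> the map \<open>b \<mapsto> u * b + v\<close> has exactly one fixed
  residue, so \<open>B\<close> is a free choice there plus a periodic set of exponents around it,
  whatever \<open>v\<close> is. For \<open>u = 1\<close> it is the identity or has no fixed residue.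
  The summand \<open>i = 0\<close> in \<open>N'\<close> is the value that the generic pattern would
  give, and the term with \<open>1/p\<close> corrects it.

  The obstacle is that a graph isomorphism need not respect the group at all; only the smallness of
  \<open>2p\<close> points against cycle lengths that are powers of \<open>p\<close> forces a
  conjugated rotation to act by translations.\<close>

lemma funpow_mult_fixed:
  assumes "(f ^^ n) x = x"
  shows "(f ^^ (n * k)) x = x"
  by (induction k) (use assms in \<open>auto simp: funpow_add\<close>)

text \<open>There is no inverse of \<open>f\<close> to work with, so Bezout is used over the
  naturals: \<open>a * s\<close> steps equal \<open>b * t\<close> steps followed by
  \<open>gcd a b\<close> steps.\<close>

lemma funpow_gcd_fixed:
  assumes "(f ^^ a) x = x" "(f ^^ b) x = x"
  shows "(f ^^ gcd a b) x = x"
proof (cases "a = 0")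
  case False
  then obtain s t where st: "a * s = b * t + gcd a b" using bezout_nat by blast
  have "x = (f ^^ (gcd a b + b * t)) x"
    using funpow_mult_fixed[OF assms(1), of s] st by (simp add: add.commute)
  also have "\<dots> = (f ^^ gcd a b) x"
    using funpow_mult_fixed[OF assms(2), of t] by (simp add: funpow_add)
  finally show ?thesis by simp
qed (use assms in simp)

text \<open>Injectivity of \<open>f\<close> is replaced by the period: \<open>N * i - i\<close>
  further steps undo the first \<open>i\<close> steps from \<open>x\<close>.\<close>

lemma funpow_fixed_of_collision:
  assumes "(f ^^ N) x = x" "N > 0" "i \<le> j" "(f ^^ i) x = (f ^^ j) x"
  shows "(f ^^ (j - i)) x = x"
proof -
  have le: "i \<le> N * i" using assms(2) by simp
  have "x = (f ^^ (N * i - i)) ((f ^^ i) x)"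
    using funpow_mult_fixed[OF assms(1), of i] le
    by (metis funpow_add le_add_diff_inverse2 o_apply)
  also have "\<dots> = (f ^^ (N * i - i + j)) x"
    using assms(4) by (simp add: funpow_add)
  also have "N * i - i + j = (j - i) + N * i" using le assms(3) by linarith
  also have "(f ^^ \<dots>) x = (f ^^ (j - i)) x"
    using funpow_mult_fixed[OF assms(1), of i] by (simp add: funpow_add)
  finally show ?thesis by simp
qed

lemma funpow_closed: "f ` X \<subseteq> X \<Longrightarrow> x \<in> X \<Longrightarrow> (f ^^ n) x \<in> X"
  by (induction n) auto

text \<open>Every cycle has length 1 or \<open>p\<close>. Without a fixed point all cycles would
  have length \<open>p\<close>, and as they partition \<open>X\<close>, \<open>p\<close> would
  divide its size.\<close>

lemma fixed_point_if_prime_period: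
  fixes p :: nat
  assumes "finite X" "f ` X \<subseteq> X" "\<And>x. x \<in> X \<Longrightarrow> (f ^^ p) x = x"
    and p: "prime p" "\<not> p dvd card X"
  shows "\<exists>x\<in>X. f x = x"
proof (rule ccontr)
  assume no: "\<not> (\<exists>x\<in>X. f x = x)"
  have p0: "p > 0" using p(1) prime_gt_0_nat by blast
  define r where "r = {(x, y). x \<in> X \<and> y \<in> X \<and> (\<exists>i. y = (f ^^ i) x)}"
  have period: "(f ^^ (p * i)) x = x" if "x \<in> X" for x i
    using funpow_mult_fixed[OF assms(3)[OF that]] .
  \<comment> \<open>Completing the remaining turns of the cycle leads back to \<open>x\<close>; this
    makes \<open>r\<close> symmetric.\<close>
  have ret: "x = (f ^^ (p * i - i)) ((f ^^ i) x)" if "x \<in> X" for x i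
  proof -
    have "p * i - i + i = p * i" using p0 by simp
    then show ?thesis using period[OF that, of i] by (metis funpow_add o_apply)
  qed
  have eq: "equiv X r"
  proof (rule equivI)
    show "r \<subseteq> X \<times> X" by (auto simp: r_def)
    show "refl_on X r" by (auto simp: refl_on_def r_def intro: exI[of _ 0])
    show "sym r" using ret by (fastforce simp: sym_def r_def)
    show "trans r"
    proof (rule transI)
      fix x y z assume "(x, y) \<in> r" "(y, z) \<in> r"
      then obtain i j where "x \<in> X" "z \<in> X" "y = (f ^^ i) x" "z = (f ^^ j) y"
        by (auto simp: r_def)
      then show "(x, z) \<in> r"
        by (auto simp: r_def intro!: exI[of _ "j + i"] simp: funpow_add)
    qed
  qed
  have "card c = p" if "c \<in> X // r" for c
  proof -
    from that obtain x where x: "x \<in> X" "c = r `` {x}" by (auto simp: quotient_def)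
    have "c = (\<lambda>i. (f ^^ i) x) ` {..<p}"
    proof (intro equalityI subsetI)
      fix y assume "y \<in> c"
      then obtain i where i: "y = (f ^^ i) x" using x by (auto simp: r_def)
      have "(f ^^ i) x = (f ^^ (i mod p + p * (i div p))) x" by simp
      also have "\<dots> = (f ^^ (i mod p)) x"
        by (simp only: funpow_add o_apply period[OF x(1)])
      finally show "y \<in> (\<lambda>i. (f ^^ i) x) ` {..<p}" using i p0 by auto
    qed (use x funpow_closed[OF assms(2)] in \<open>auto simp: r_def\<close>)
    moreover have "inj_on (\<lambda>i. (f ^^ i) x) {..<p}"
    proof (rule linorder_inj_onI)
      fix i j assume ij: "i < j" "i \<in> {..<p}" "j \<in> {..<p}"
      show "(f ^^ i) x \<noteq> (f ^^ j) x"
      proof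
        assume "(f ^^ i) x = (f ^^ j) x"
        then have "(f ^^ (j - i)) x = x"
          using funpow_fixed_of_collision[OF assms(3)[OF x(1)] p0] ij by simp
        then have "(f ^^ gcd (j - i) p) x = x"
          using assms(3)[OF x(1)] by (rule funpow_gcd_fixed)
        moreover have "coprime (j - i) p"
          using ij p(1) by (metis coprime_commute lessThan_iff less_imp_diff_less nat_dvd_not_less
              prime_imp_coprime zero_less_diff)
        ultimately show False using no x by simp
      qed
    qed auto
    ultimately show ?thesis by (simp add: card_image)
  qed
  then have "p dvd card (\<Union> (X // r))"
    using equiv_imp_dvd_card[OF assms(1) eq] by (metis Union_quotient dvd_refl eq)
  then show False using p(2) Union_quotient[OF eq] by simp
qed

text \<open>The cycle of \<open>x\<close> has a length that divides \<open>p ^ a\<close>, yet by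
  pigeonhole some return time is at most \<open>card W < p\<close> and hence coprime to
  \<open>p\<close>.\<close>

lemma fixed_if_prime_power_period:
  fixes p :: nat
  assumes p: "prime p" and W: "finite W" "card W < p" "f ` W \<subseteq> W" "x \<in> W"
    and "(f ^^ (p ^ a)) x = x"
  shows "f x = x"
proof -
  have "\<not> inj_on (\<lambda>i. (f ^^ i) x) {..card W}"
    using card_inj_on_le[of "\<lambda>i. (f ^^ i) x" "{..card W}" W] W funpow_closed[OF W(3,4)] by auto
  then obtain i j where ij: "i < j" "j \<le> card W" "(f ^^ i) x = (f ^^ j) x"
    unfolding inj_on_def by (metis atMost_iff linorder_neqE_nat)
  have "(f ^^ (j - i)) x = x"
    by (rule funpow_fixed_of_collision[OF assms(6)]) (use p ij in \<open>auto simp: prime_gt_0_nat\<close>)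
  then have "(f ^^ gcd (j - i) (p ^ a)) x = x" using assms(6) by (rule funpow_gcd_fixed)
  moreover have "\<not> p dvd (j - i)" using ij W(2) by (auto dest!: dvd_imp_le)
  then have "coprime (j - i) (p ^ a)"
    using p by (metis coprime_commute coprime_power_right_iff prime_imp_coprime)
  ultimately show ?thesis by simp
qed

text \<open>The conjugacy part of Sylow's theorem, for single elements. The cosets of a Sylow
  subgroup \<open>P\<close> number \<open>m\<close>, prime to \<open>p\<close>, so right
  multiplication by \<open>q\<close> fixes some coset \<open>P #> g\<close>, which says that
  \<open>g \<otimes> q \<otimes> inv g\<close> lies in \<open>P\<close>. Passing to a conjugate of
  \<open>P\<close> places the prescribed \<open>r\<close> in it without conjugating \<open>r\<close>
  itself.\<close>

lemma (in group) sylow_subgroup_conjugates: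
  assumes fin: "finite (carrier G)" and p: "prime p"
    and r: "r \<in> carrier G" "r [^] p = \<one>"
  obtains P a where "subgroup P G" "card P = p ^ a" "r \<in> P"
    "\<And>q. q \<in> carrier G \<Longrightarrow> q [^] p = \<one> \<Longrightarrow> \<exists>g\<in>carrier G. g \<otimes> q \<otimes> inv g \<in> P"
proof -
  have "order G \<noteq> 0" using fin order_gt_0_iff_finite by simp
  then obtain a m where am: "order G = p ^ a * m" "\<not> p dvd m"
    using multiplicity_decompose'[of "order G" p] p not_prime_unit by blast
  from sylow_thm[OF p is_group am(1) fin] obtain P where P: "subgroup P G" "card P = p ^ a"
    by blast
  have Psub: "P \<subseteq> carrier G" using subgroup.subset[OF P(1)] .
  have "card (rcosets P) * p ^ a = p ^ a * m"
    using lagrange[OF P(1)] am P by simp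
  then have idx: "card (rcosets P) = m" using p prime_gt_0_nat[of p] by simp
  have conj: "\<exists>g\<in>carrier G. g \<otimes> q \<otimes> inv g \<in> P" if q: "q \<in> carrier G" "q [^] p = \<one>" for q
  proof -
    define f where "f = (\<lambda>C. C #> q)"
    have f: "(f ^^ n) C = C #> (q [^] n)" if "C \<in> rcosets P" for C n
    proof -
      have "C \<subseteq> carrier G" using subgroup.rcosets_carrier[OF P(1) is_group that] .
      then show ?thesis by (induction n) (use q in \<open>auto simp: f_def coset_mult_assoc\<close>)
    qed
    have "\<exists>C\<in>rcosets P. f C = C"
    proof (rule fixed_point_if_prime_period[OF _ _ _ p])
      show "finite (rcosets P)" using fin by (simp add: RCOSETS_def)
      show "f ` (rcosets P) \<subseteq> rcosets P"
        using q Psub by (auto simp: f_def RCOSETS_def coset_mult_assoc)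
      show "(f ^^ p) C = C" if "C \<in> rcosets P" for C
        using f[OF that] q subgroup.rcosets_carrier[OF P(1) is_group that] by simp
      show "\<not> p dvd card (rcosets P)" using idx am by simp
    qed
    then obtain g where g: "g \<in> carrier G" "P #> g #> q = P #> g"
      by (auto simp: f_def RCOSETS_def)
    have "P #> (g \<otimes> q \<otimes> inv g) = P"
      by (rule coset_mult_inv2) (use g q Psub in \<open>simp_all flip: coset_mult_assoc\<close>)
    then have "g \<otimes> q \<otimes> inv g \<in> P"
      by (rule coset_join1) (use g q P(1) in auto)
    with g show ?thesis by blast
  qed
  from conj[OF r] obtain g where g: "g \<in> carrier G" "g \<otimes> r \<otimes> inv g \<in> P" by blast
  \<comment> \<open>Since \<open>g\<close> carries \<open>r\<close> into \<open>P\<close>, this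
    conjugate of \<open>P\<close> contains \<open>r\<close>.\<close>
  define Q where "Q = inv g <# P #> g"
  have Q_iff: "x \<in> Q \<longleftrightarrow> g \<otimes> x \<otimes> inv g \<in> P" if x: "x \<in> carrier G" for x
  proof
    assume "x \<in> Q"
    then obtain y where "y \<in> P" "x = inv g \<otimes> y \<otimes> g"
      by (auto simp: Q_def l_coset_def r_coset_def)
    then show "g \<otimes> x \<otimes> inv g \<in> P" using conjugation_is_surj[OF g(1), of y] Psub by auto
  next
    assume A: "g \<otimes> x \<otimes> inv g \<in> P"
    have "x = inv g \<otimes> (g \<otimes> x \<otimes> inv g) \<otimes> g"
      using conjugation_is_surj[of "inv g" x] g x by simp
    with A show "x \<in> Q" by (auto simp: Q_def l_coset_def r_coset_def)
  qed
  show thesis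
  proof (rule that)
    show Q: "subgroup Q G" unfolding Q_def by (rule subgroup_conjugation_is_surj1[OF g(1) P(1)])
    have "bij_betw (\<lambda>x. inv g \<otimes> x \<otimes> g) P Q"
      unfolding bij_betw_def
    proof
      show "inj_on (\<lambda>x. inv g \<otimes> x \<otimes> g) P"
        using g Psub by (auto simp: inj_on_def subset_iff)
      show "(\<lambda>x. inv g \<otimes> x \<otimes> g) ` P = Q"
        by (auto simp: Q_def l_coset_def r_coset_def)
    qed
    then show "card Q = p ^ a" using P(2) bij_betw_same_card by metis
    show "r \<in> Q" using Q_iff[OF r(1)] g by simp
    fix q assume q: "q \<in> carrier G" "q [^] p = \<one>"
    from conj[OF q] obtain h where h: "h \<in> carrier G" "h \<otimes> q \<otimes> inv h \<in> P" by blast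
    \<comment> \<open>\<open>h\<close> brings \<open>q\<close> into \<open>P\<close>, and
      \<open>inv g\<close> then moves it from \<open>P\<close> to \<open>Q\<close>.\<close>
    have "g \<otimes> ((inv g \<otimes> h) \<otimes> q \<otimes> inv (inv g \<otimes> h)) \<otimes> inv g = h \<otimes> q \<otimes> inv h"
      using g h q by (simp add: inv_mult_group m_assoc) (simp flip: m_assoc)
    with h have "(inv g \<otimes> h) \<otimes> q \<otimes> inv (inv g \<otimes> h) \<in> Q"
      using Q_iff[of "(inv g \<otimes> h) \<otimes> q \<otimes> inv (inv g \<otimes> h)"] g q by simp
    then show "\<exists>g\<in>carrier G. g \<otimes> q \<otimes> inv g \<in> Q" using g h by blast
  qed
qed

section \<open>Permutation groups\<close>

lemma BijGroup_simps:
  shows carrier_BijGroup: "carrier (BijGroup V) = Bij V"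
    and BijGroup_mult_apply:
      "\<lbrakk>f \<in> Bij V; g \<in> Bij V; x \<in> V\<rbrakk> \<Longrightarrow> (f \<otimes>\<^bsub>BijGroup V\<^esub> g) x = f (g x)"
    and BijGroup_one_apply: "x \<in> V \<Longrightarrow> \<one>\<^bsub>BijGroup V\<^esub> x = x"
  by (auto simp: BijGroup_def compose_def)

lemma Bij_apply_closed: "f \<in> Bij V \<Longrightarrow> x \<in> V \<Longrightarrow> f x \<in> V"
  by (rule funcset_mem[OF Bij_imp_funcset])

lemma Bij_apply_eq_iff: "f \<in> Bij V \<Longrightarrow> x \<in> V \<Longrightarrow> y \<in> V \<Longrightarrow> f x = f y \<longleftrightarrow> x = y"
  by (auto simp: Bij_def bij_betw_def inj_on_def)

lemma BijGroup_pow_apply: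
  assumes "f \<in> Bij V" "x \<in> V"
  shows "(f [^]\<^bsub>BijGroup V\<^esub> (n::nat)) x = (f ^^ n) x"
proof -
  interpret group "BijGroup V" by (rule group_BijGroup)
  have *: "f [^]\<^bsub>BijGroup V\<^esub> (n::nat) \<in> Bij V" for n
    using assms nat_pow_closed[of f n] by (simp add: carrier_BijGroup)
  have "x \<in> V \<Longrightarrow> (f [^]\<^bsub>BijGroup V\<^esub> (n::nat)) x = (f ^^ n) x" for x
  proof (induction n arbitrary: x)
    case (Suc n)
    have "(f [^]\<^bsub>BijGroup V\<^esub> Suc n) x = (f [^]\<^bsub>BijGroup V\<^esub> n) (f x)"
      using BijGroup_mult_apply[OF * assms(1) Suc.prems] by simp
    also have "\<dots> = (f ^^ n) (f x)" by (rule Suc.IH[OF Bij_apply_closed[OF assms(1) Suc.prems]])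
    finally show ?case by (simp add: funpow_swap1)
  qed (simp add: BijGroup_one_apply)
  with assms show ?thesis by blast
qed

lemma Bij_eqI:
  assumes "f \<in> Bij V" "g \<in> Bij V" "\<And>x. x \<in> V \<Longrightarrow> f x = g x"
  shows "f = g"
  by (rule extensionalityI[OF Bij_imp_extensional[OF assms(1)] Bij_imp_extensional[OF assms(2)]])
     (rule assms(3))

lemma BijGroup_inv_apply:
  assumes "f \<in> Bij V" "x \<in> V"
  shows "(inv\<^bsub>BijGroup V\<^esub> f) x \<in> V" "f ((inv\<^bsub>BijGroup V\<^esub> f) x) = x"
    "(inv\<^bsub>BijGroup V\<^esub> f) (f x) = x"
proof -
  have "bij_betw f V V" "f x \<in> V" using assms Bij_apply_closed[OF assms] by (simp_all add: Bij_def)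
  then show "(inv\<^bsub>BijGroup V\<^esub> f) x \<in> V" "f ((inv\<^bsub>BijGroup V\<^esub> f) x) = x"
    "(inv\<^bsub>BijGroup V\<^esub> f) (f x) = x"
    using assms by (auto simp: inv_BijGroup bij_betw_inv_into_right bij_betw_inv_into_left
        Bij_inv_into_mem)
qed

definition rel_auto :: "'a set \<Rightarrow> ('a \<Rightarrow> 'a \<Rightarrow> bool) \<Rightarrow> ('a \<Rightarrow> 'a) set" where
  "rel_auto V E = {f \<in> Bij V. \<forall>x\<in>V. \<forall>y\<in>V. E (f x) (f y) \<longleftrightarrow> E x y}"

lemma subgroup_rel_auto: "subgroup (rel_auto V E) (BijGroup V)"
proof -
  interpret group "BijGroup V" by (rule group_BijGroup)
  show ?thesis
  proof (rule subgroup.intro)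
    show "rel_auto V E \<subseteq> carrier (BijGroup V)" by (auto simp: rel_auto_def carrier_BijGroup)
    fix f g assume fg: "f \<in> rel_auto V E" "g \<in> rel_auto V E"
    then have "f \<otimes>\<^bsub>BijGroup V\<^esub> g \<in> Bij V"
      using m_closed[of f g] by (auto simp: rel_auto_def carrier_BijGroup)
    with fg show "f \<otimes>\<^bsub>BijGroup V\<^esub> g \<in> rel_auto V E"
      by (auto simp: rel_auto_def BijGroup_mult_apply Bij_apply_closed)
  next
    show "\<one>\<^bsub>BijGroup V\<^esub> \<in> rel_auto V E"
      using one_closed by (auto simp: rel_auto_def carrier_BijGroup BijGroup_one_apply)
  next
    fix f assume f: "f \<in> rel_auto V E"
    then have fB: "f \<in> Bij V" by (auto simp: rel_auto_def)
    have "E ((inv\<^bsub>BijGroup V\<^esub> f) x) ((inv\<^bsub>BijGroup V\<^esub> f) y) \<longleftrightarrow> E x y"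
      if "x \<in> V" "y \<in> V" for x y
    proof -
      have "E (f x') (f y') \<longleftrightarrow> E x' y'" if "x' \<in> V" "y' \<in> V" for x' y'
        using f that by (simp add: rel_auto_def)
      from this[OF BijGroup_inv_apply(1)[OF fB that(1)] BijGroup_inv_apply(1)[OF fB that(2)]]
      show ?thesis using BijGroup_inv_apply(2)[OF fB] that by simp
    qed
    then show "inv\<^bsub>BijGroup V\<^esub> f \<in> rel_auto V E"
      using inv_closed[of f] fB by (auto simp: rel_auto_def carrier_BijGroup)
  qed
qed

lemma finite_Bij: "finite V \<Longrightarrow> finite (Bij V)"
proof (rule finite_subset)
  show "Bij V \<subseteq> V \<rightarrow>\<^sub>E V" using Bij_imp_funcset by (auto simp: PiE_def Bij_imp_extensional)
qed (simp add: finite_PiE)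

section \<open>Dihedral groups and their affine automorphisms\<close>

lemma carrier_dihedral_group: "carrier (dihedral_group n) = {0..<int n} \<times> UNIV"
  by (simp add: dihedral_group_def)

lemma dihedral_mult:
  "(a, s) \<otimes>\<^bsub>dihedral_group n\<^esub> (b, t) = ((if s then a - b else a + b) mod int n, s \<noteq> t)"
  by (simp add: dihedral_group_def)

lemma dihedral_one: "\<one>\<^bsub>dihedral_group n\<^esub> = (0, False)"
  by (simp add: dihedral_group_def)

lemma dihedral_inv:
  assumes "n > 0" "(a, s) \<in> carrier (dihedral_group n)"
  shows "inv\<^bsub>dihedral_group n\<^esub> (a, s) = (if s then a else (- a) mod int n, s)"
proof -
  interpret group "dihedral_group n" by (rule group_dihedral_group[OF assms(1)])
  show ?thesis
    by (rule inv_equality)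
       (use assms in \<open>auto simp: carrier_dihedral_group dihedral_mult dihedral_one mod_simps\<close>)
qed

text \<open>The label of an arc: exponents subtract between vertices of the same type and add
  between a rotation and a reflection, because a reflection is its own inverse and inverts
  rotations.\<close>

lemma dihedral_quotient:
  assumes "n > 0" "(a, s) \<in> carrier (dihedral_group n)" "(b, t) \<in> carrier (dihedral_group n)"
  shows "(b, t) \<otimes>\<^bsub>dihedral_group n\<^esub> inv\<^bsub>dihedral_group n\<^esub> (a, s)
    = ((if s = t then b - a else a + b) mod int n, s \<noteq> t)"
  using assms by (cases s; cases t) (simp_all add: dihedral_inv dihedral_mult mod_simps add.commute)

text \<open>Reflections are involutions, so closure under inverses constrains only the rotations of
  \<open>S\<close>; its set of reflections is arbitrary.\<close>

lemma cayley_set_dihedral_iff: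
  assumes "n > 0"
  shows "cayley_set (dihedral_group n) S \<longleftrightarrow>
    S \<subseteq> carrier (dihedral_group n) \<and> (0, False) \<notin> S \<and>
    (\<forall>a. (a, False) \<in> S \<longrightarrow> ((- a) mod int n, False) \<in> S)" (is "?L \<longleftrightarrow> ?R")
proof -
  interpret group "dihedral_group n" by (rule group_dihedral_group[OF assms])
  let ?i = "m_inv (dihedral_group n)"
  show ?thesis
  proof
    assume L: ?L
    then have sub: "S \<subseteq> carrier (dihedral_group n)" and img: "?i ` S = S"
      by (auto simp: cayley_set_def)
    have "((- a) mod int n, False) \<in> S" if a: "(a, False) \<in> S" for a
      using imageI[OF a, of ?i] a sub img dihedral_inv[OF assms, of a False] by auto
    with L show ?R by (auto simp: cayley_set_def dihedral_one)
  next
    assume R: ?R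
    have cl: "?i x \<in> S" if "x \<in> S" for x
      using that R dihedral_inv[OF assms, of "fst x" "snd x"] by (cases x; cases "snd x") auto
    have "?i ` S = S"
    proof (intro equalityI subsetI)
      fix x assume x: "x \<in> S"
      then have "x = ?i (?i x)" using R by auto
      with cl[OF x] show "x \<in> ?i ` S" by blast
    qed (use cl in auto)
    with R show ?L by (auto simp: cayley_set_def dihedral_one)
  qed
qed

text \<open>Restricted to the carrier because \<open>Bij\<close>, and with it \<open>auto\<close>,
  consists of extensional functions.\<close>

definition dihedral_affine :: "nat \<Rightarrow> int \<Rightarrow> int \<Rightarrow> int \<times> bool \<Rightarrow> int \<times> bool" where
  "dihedral_affine n u v =
    (\<lambda>(a, s)\<in>carrier (dihedral_group n). ((u * a + (if s then v else 0)) mod int n, s))"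

lemma dihedral_affine_apply:
  "(a, s) \<in> carrier (dihedral_group n) \<Longrightarrow>
    dihedral_affine n u v (a, s) = ((u * a + (if s then v else 0)) mod int n, s)"
  by (simp add: dihedral_affine_def)

lemma mod_mult_left_cancel:
  fixes u m a b :: int
  assumes "coprime u m" "(u * a + v) mod m = (u * b + v) mod m"
  shows "a mod m = b mod m"
proof -
  have "m dvd (u * a + v) - (u * b + v)" using assms(2) mod_eq_dvd_iff by blast
  then have "m dvd u * (a - b)" by (simp add: algebra_simps)
  then have "m dvd a - b" using assms(1) coprime_commute coprime_dvd_mult_right_iff by blast
  then show ?thesis using mod_eq_dvd_iff by blast
qed

lemma mod_affine_mod:
  fixes u x c n :: int
  shows "(u * (x mod n) + c) mod n = (u * x + c) mod n"
  using mod_add_left_eq[of "u * (x mod n)" n c] mod_add_left_eq[of "u * x" n c]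
  by (simp add: mod_mult_right_eq)

lemma dihedral_affine_Bij:
  assumes "n > 0" "coprime u (int n)"
  shows "dihedral_affine n u v \<in> Bij (carrier (dihedral_group n))"
proof -
  let ?V = "carrier (dihedral_group n)" and ?f = "dihedral_affine n u v"
  have fin: "finite ?V" by (simp add: carrier_dihedral_group)
  have sub: "?f ` ?V \<subseteq> ?V"
    using assms(1) by (auto simp: dihedral_affine_apply) (auto simp: carrier_dihedral_group)
  have "inj_on ?f ?V"
  proof (rule inj_onI)
    fix x y assume xy: "x \<in> ?V" "y \<in> ?V" "?f x = ?f y"
    obtain a s b t where [simp]: "x = (a, s)" "y = (b, t)" by (cases x; cases y)
    have "s = t" using xy by (simp add: dihedral_affine_apply)
    moreover have "(u * a + (if s then v else 0)) mod int n = (u * b + (if s then v else 0)) mod int n"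
      using xy \<open>s = t\<close> by (simp add: dihedral_affine_apply)
    then have "a mod int n = b mod int n" by (rule mod_mult_left_cancel[OF assms(2)])
    ultimately show "x = y" using xy(1,2) by (simp add: carrier_dihedral_group)
  qed
  then have "bij_betw ?f ?V ?V"
    unfolding bij_betw_def using endo_inj_surj[OF fin sub] by blast
  then show ?thesis by (simp add: Bij_def dihedral_affine_def)
qed

lemma dihedral_affine_auto:
  assumes "n > 0" "coprime u (int n)"
  shows "dihedral_affine n u v \<in> auto (dihedral_group n)"
proof -
  let ?D = "dihedral_group n" and ?f = "dihedral_affine n u v"
  interpret group ?D by (rule group_dihedral_group[OF assms(1)])
  note B = dihedral_affine_Bij[OF assms, of v]
  have "?f \<in> hom ?D ?D"
  proof (rule homI)
    fix x y assume xy: "x \<in> carrier ?D" "y \<in> carrier ?D"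
    obtain a s b t where [simp]: "x = (a, s)" "y = (b, t)" by (cases x; cases y)
    have "x \<otimes>\<^bsub>?D\<^esub> y \<in> carrier ?D" using xy by simp
    with xy show "?f (x \<otimes>\<^bsub>?D\<^esub> y) = ?f x \<otimes>\<^bsub>?D\<^esub> ?f y"
      by (cases s; cases t)
         (simp_all add: dihedral_mult dihedral_affine_apply mod_simps mod_affine_mod,
          simp_all add: algebra_simps)
  qed (rule Bij_apply_closed[OF B])
  with B show ?thesis by (simp add: auto_def)
qed

section \<open>The isomorphism problem for Cayley graphs\<close>

text \<open>Right multiplication is the right side here, since it cancels in
  \<open>y \<otimes> inv x\<close>. On reflections the shift is by -1, as
  \<open>\<tau>\<^sup>a\<sigma>\<tau> = \<tau>\<^sup>a\<^sup>-\<^sup>1\<sigma>\<close>.\<close>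

definition dihedral_rot :: "nat \<Rightarrow> int \<times> bool \<Rightarrow> int \<times> bool" where
  "dihedral_rot n = (\<lambda>(a, s)\<in>carrier (dihedral_group n). ((if s then a - 1 else a + 1) mod int n, s))"

lemma dihedral_rot_eq:
  assumes "n > 0" "x \<in> carrier (dihedral_group n)"
  shows "dihedral_rot n x = x \<otimes>\<^bsub>dihedral_group n\<^esub> dihedral_tau n"
  using assms by (cases x) (simp add: dihedral_rot_def dihedral_tau_def dihedral_mult mod_simps)

lemma dihedral_rot_Bij:
  assumes "n > 0"
  shows "dihedral_rot n \<in> Bij (carrier (dihedral_group n))"
proof -
  interpret group "dihedral_group n" by (rule group_dihedral_group[OF assms])
  let ?V = "carrier (dihedral_group n)"
  have t: "dihedral_tau n \<in> ?V" by (rule dihedral_relations(1)[OF assms])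
  have fin: "finite ?V" by (simp add: carrier_dihedral_group)
  have "inj_on (dihedral_rot n) ?V"
    using t by (intro inj_onI) (simp add: dihedral_rot_eq[OF assms])
  moreover have "dihedral_rot n ` ?V \<subseteq> ?V"
    using t by (auto simp: dihedral_rot_eq[OF assms])
  ultimately have "bij_betw (dihedral_rot n) ?V ?V"
    unfolding bij_betw_def using endo_inj_surj[OF fin] by blast
  then show ?thesis by (simp add: Bij_def dihedral_rot_def)
qed

lemma dihedral_rot_funpow:
  assumes "n > 0" "(a, s) \<in> carrier (dihedral_group n)"
  shows "(dihedral_rot n ^^ k) (a, s) = ((if s then a - int k else a + int k) mod int n, s)"
proof (induction k)
  case 0
  then show ?case using assms by (simp add: carrier_dihedral_group)
next
  case (Suc k)
  have "((if s then a - int k else a + int k) mod int n, s) \<in> carrier (dihedral_group n)"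
    using assms by (simp add: carrier_dihedral_group)
  then show ?case using Suc by (simp add: dihedral_rot_def mod_simps algebra_simps)
qed

lemma dihedral_rot_reaches:
  assumes "n > 0" "(a, s) \<in> carrier (dihedral_group n)" "(b, s) \<in> carrier (dihedral_group n)"
  obtains k where "(dihedral_rot n ^^ k) (a, s) = (b, s)"
proof
  show "(dihedral_rot n ^^ nat ((if s then a - b else b - a) mod int n)) (a, s) = (b, s)"
    using assms by (simp add: dihedral_rot_funpow mod_simps) (simp add: carrier_dihedral_group)
qed

text \<open>If \<open>f\<close> changed the type of \<open>x\<close>, the \<open>P\<close>-orbit of
  \<open>x\<close> would meet both rotation orbits and, as \<open>P\<close> contains the rotation,
  be all of \<open>V\<close>. Then \<open>2 * p\<close> would divide the odd number
  \<open>p ^ a\<close>.\<close>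

lemma p_group_preserves_rotation_orbits:
  fixes p :: nat
  defines "V \<equiv> carrier (dihedral_group p)"
  assumes p: "prime p" "odd p" and P: "subgroup P (BijGroup V)" "card P = p ^ a"
    and rot: "dihedral_rot p \<in> P" and f: "f \<in> P" and x: "x \<in> V"
  shows "snd (f x) = snd x"
proof (rule ccontr)
  assume ne: "snd (f x) \<noteq> snd x"
  have p0: "p > 0" using p prime_gt_0_nat by blast
  interpret B: group "BijGroup V" by (rule group_BijGroup)
  let ?G = "BijGroup V \<lparr>carrier := P\<rparr>"
  have PB: "g \<in> Bij V" if "g \<in> P" for g
    using subgroup.subset[OF P(1)] that by (auto simp: carrier_BijGroup)
  have "group_hom ?G (BijGroup V) id" by (rule B.canonical_inj_is_hom[OF P(1)])
  then interpret A: group_action ?G V id by (simp add: group_action_def)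
  let ?O = "orbit ?G id x"
  have cl: "g y \<in> ?O" if y: "y \<in> ?O" and g: "g \<in> P" for y g
  proof -
    from y obtain h where h: "h \<in> P" "y = h x" by (auto simp: orbit_def)
    have "g \<otimes>\<^bsub>BijGroup V\<^esub> h \<in> P" by (rule subgroup.m_closed[OF P(1) g h(1)])
    moreover have "g y = (g \<otimes>\<^bsub>BijGroup V\<^esub> h) x"
      using BijGroup_mult_apply[OF PB[OF g] PB[OF h(1)] x] h by simp
    ultimately show ?thesis by (auto simp: orbit_def)
  qed
  have xO: "x \<in> ?O" by (rule A.orbit_refl[OF x])
  have "g x \<in> V" if "g \<in> P" for g by (rule Bij_apply_closed[OF PB[OF that] x])
  then have sub: "?O \<subseteq> V" by (auto simp: orbit_def)
  have same: "(b, s) \<in> ?O" if cO: "(c, s) \<in> ?O" and bV: "(b, s) \<in> V" for b c s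
  proof -
    have "(c, s) \<in> V" using cO sub by blast
    then obtain k where k: "(dihedral_rot p ^^ k) (c, s) = (b, s)"
      using dihedral_rot_reaches[OF p0] bV unfolding V_def by metis
    have "(dihedral_rot p ^^ k) (c, s) \<in> ?O"
      by (rule funpow_closed[OF _ cO]) (use cl rot in auto)
    then show ?thesis by (simp add: k)
  qed
  have "?O = V"
  proof (intro equalityI subsetI)
    fix y assume y: "y \<in> V"
    have "f x \<in> ?O" by (rule cl[OF xO f])
    then have "(fst (f x), snd (f x)) \<in> ?O" "(fst x, snd x) \<in> ?O"
      using xO by (simp_all only: prod.collapse)
    moreover have "snd y = snd (f x) \<or> snd y = snd x" using ne by blast
    ultimately have "\<exists>c. (c, snd y) \<in> ?O" by (elim disjE) (erule ssubst, blast)+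
    then obtain c where "(c, snd y) \<in> ?O" by blast
    moreover have "(fst y, snd y) \<in> V" using y by simp
    ultimately have "(fst y, snd y) \<in> ?O" by (rule same)
    then show "y \<in> ?O" by simp
  qed (use sub in blast)
  then have "card V * card (stabilizer ?G id x) = p ^ a"
    using A.orbit_stabilizer_theorem[OF x] P(2) by (simp add: order_def)
  moreover have "card V = 2 * p"
    using order_dihedral_group[of p] by (simp add: order_def V_def)
  ultimately have "even (p ^ a)" by (metis dvd_triv_left dvd_mult2)
  with p show False by simp
qed

text \<open>Follow \<open>f\<close> by the power of the rotation that brings \<open>(0, s)\<close>
  back to itself. The result \<open>g\<close> has order a power of \<open>p\<close> and permutes the
  other \<open>p - 1\<close> points of type \<open>s\<close>, too few for a nontrivial cycle, so it
  fixes that type pointwise. The shift \<open>k\<close> may depend on \<open>s\<close>.\<close>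

lemma p_group_acts_by_translations:
  fixes p :: nat
  defines "V \<equiv> carrier (dihedral_group p)"
  assumes p: "prime p" "odd p" and P: "subgroup P (BijGroup V)" "card P = p ^ a"
    and rot: "dihedral_rot p \<in> P" and f: "f \<in> P"
  shows "\<exists>k. \<forall>b\<in>{0..<int p}. f (b, s) = ((b + k) mod int p, s)"
proof -
  have p0: "p > 0" using p prime_gt_0_nat by blast
  interpret B: group "BijGroup V" by (rule group_BijGroup)
  have PB: "g \<in> Bij V" if "g \<in> P" for g
    using subgroup.subset[OF P(1)] that by (auto simp: carrier_BijGroup)
  have snd: "snd (g x) = snd x" if "g \<in> P" "x \<in> V" for g x
    using p_group_preserves_rotation_orbits[OF p, of P a g x] P rot that unfolding V_def by blast
  have V: "(b, s) \<in> V \<longleftrightarrow> b \<in> {0..<int p}" for b s by (simp add: V_def carrier_dihedral_group)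
  have z: "(0, s) \<in> V" using p0 by (simp add: V)
  obtain k where k: "f (0, s) = (k, s)" "(k, s) \<in> V"
    using snd[OF f z] Bij_apply_closed[OF PB[OF f] z] by (cases "f (0, s)") auto
  obtain m where m: "(dihedral_rot p ^^ m) (k, s) = (0, s)"
    using dihedral_rot_reaches[OF p0] k(2) z unfolding V_def by metis
  define r where "r = dihedral_rot p [^]\<^bsub>BijGroup V\<^esub> m"
  have rP: "r \<in> P" unfolding r_def
    by (metis B.nat_pow_consistent B.subgroup_imp_group P(1) group.is_monoid monoid.nat_pow_closed
        partial_object.select_convs(1) partial_object.surjective partial_object.update_convs(1) rot)
  have r: "r x = (dihedral_rot p ^^ m) x" if "x \<in> V" for x
    unfolding r_def using BijGroup_pow_apply PB[OF rot] that by metis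
  define g where "g = r \<otimes>\<^bsub>BijGroup V\<^esub> f"
  have gP: "g \<in> P" unfolding g_def by (rule subgroup.m_closed[OF P(1) rP f])
  have g: "g x = (dihedral_rot p ^^ m) (f x)" if "x \<in> V" for x
    unfolding g_def using BijGroup_mult_apply[OF PB[OF rP] PB[OF f] that]
      r[OF Bij_apply_closed[OF PB[OF f] that]] by simp
  have g0: "g (0, s) = (0, s)" using g[OF z] k m by simp
  let ?G = "BijGroup V \<lparr>carrier := P\<rparr>"
  interpret G: group ?G by (rule B.subgroup_imp_group[OF P(1)])
  have "g [^]\<^bsub>BijGroup V\<^esub> (p ^ a) = \<one>\<^bsub>BijGroup V\<^esub>"
    using G.pow_order_eq_1[of g] gP P(2) by (simp add: order_def flip: B.nat_pow_consistent)
  then have per: "(g ^^ (p ^ a)) x = x" if "x \<in> V" for x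
    using BijGroup_pow_apply[OF PB[OF gP] that] BijGroup_one_apply[OF that] by metis
  have gfix: "g (b, s) = (b, s)" if b: "b \<in> {0..<int p}" for b
  proof (cases "b = 0")
    case False
    let ?W = "{1..<int p} \<times> {s}"
    show ?thesis
    proof (rule fixed_if_prime_power_period[OF p(1), of ?W])
      show "card ?W < p" using p0 by (simp add: card_cartesian_product)
      show "g ` ?W \<subseteq> ?W"
      proof (rule image_subsetI)
        fix x assume x: "x \<in> ?W"
        then have xV: "x \<in> V" "x \<noteq> (0, s)" "snd x = s" by (auto simp: V)
        have "g x \<in> V" "snd (g x) = s" "g x \<noteq> (0, s)"
          using Bij_apply_closed[OF PB[OF gP] xV(1)] snd[OF gP xV(1)] xV
            Bij_apply_eq_iff[OF PB[OF gP] xV(1) z] g0 by auto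
        then show "g x \<in> ?W" by (cases "g x") (auto simp: V)
      qed
      show "(g ^^ (p ^ a)) (b, s) = (b, s)" using per b by (simp add: V)
    qed (use b False in auto)
  qed (use g0 in simp)
  show ?thesis
  proof (intro exI[of _ k] ballI)
    fix b assume b: "b \<in> {0..<int p}"
    then have bV: "(b, s) \<in> V" by (simp add: V)
    obtain c where c: "f (b, s) = (c, s)" "(c, s) \<in> V"
      using snd[OF f bV] Bij_apply_closed[OF PB[OF f] bV] by (cases "f (b, s)") auto
    \<comment> \<open>The shift that \<open>dihedral_rot p ^^ m\<close> performs on type
      \<open>s\<close>. It takes \<open>c\<close> to \<open>b\<close> and \<open>k\<close> to 0, so
      \<open>c - k\<close> and \<open>b\<close> agree modulo \<open>p\<close>.\<close>
    let ?e = "if s then - int m else int m"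
    have "(c + ?e) mod int p = b"
      using gfix[OF b] g[OF bV] c dihedral_rot_funpow[OF p0, of c s m] by (auto simp: V_def split: if_splits)
    moreover have "(k + ?e) mod int p = 0"
      using m k(2) dihedral_rot_funpow[OF p0, of k s m] by (auto simp: V_def split: if_splits)
    ultimately have "(c - k) mod int p = b mod int p"
      using b by (metis (no_types, opaque_lifting) add_diff_cancel_right diff_zero mod_diff_eq)
    then have "(b + k) mod int p = (c - k + k) mod int p" by (metis mod_add_left_eq)
    then show "f (b, s) = ((b + k) mod int p, s)" using c by (simp add: V)
  qed
qed

lemma (in group) right_mult_quotient:
  assumes "x \<in> carrier G" "y \<in> carrier G" "k \<in> carrier G"
  shows "(y \<otimes> k) \<otimes> inv (x \<otimes> k) = y \<otimes> inv x"
  using assms by (simp add: inv_mult_group m_assoc) (simp flip: m_assoc)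

text \<open>\<open>f\<close> turns steps of length \<open>k\<close> from \<open>(0, s)\<close> into
  steps of length 1 or -1 from \<open>f (0, s)\<close>. Since the rotation has no fixed point,
  \<open>k\<close> is invertible modulo \<open>p\<close>, and every residue is reached; the slope is
  plus or minus the inverse of \<open>k\<close>.\<close>

lemma bij_affine_of_conjugated_rotation:
  fixes p :: nat
  defines "V \<equiv> carrier (dihedral_group p)"
  assumes p: "prime p" and f: "bij_betw f V V"
    and g: "\<And>b. b \<in> {0..<int p} \<Longrightarrow> g (b, s) = ((b + k) mod int p, s)"
    and conj: "\<And>x. x \<in> V \<Longrightarrow> f (g x) = dihedral_rot p (f x)"
  shows "\<exists>c t u. coprime u (int p) \<and> (\<forall>b\<in>{0..<int p}. f (b, s) = ((c + u * b) mod int p, t))"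
proof -
  have p0: "p > 0" and p1: "int p > 1" using prime_gt_1_nat[OF p] by simp_all
  have V: "(b, t) \<in> V \<longleftrightarrow> b \<in> {0..<int p}" for b t by (simp add: V_def carrier_dihedral_group)
  obtain c t where ct: "f (0, s) = (c, t)" by (cases "f (0, s)")
  have "(0, s) \<in> V" using p0 by (simp add: V)
  then have ctV: "(c, t) \<in> V" using bij_betwE[OF f] ct by force
  have gn: "(g ^^ n) (0, s) = ((int n * k) mod int p, s)" for n
  proof (induction n)
    case (Suc n)
    then show ?case using g[of "(int n * k) mod int p"] p0
      by (simp add: mod_simps algebra_simps)
  qed simp
  have fn: "f ((int n * k) mod int p, s) = (dihedral_rot p ^^ n) (c, t)" for n
  proof (induction n)
    case (Suc n)
    have mem: "((int n * k) mod int p, s) \<in> V" using p0 by (simp add: V)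
    have "f ((int (Suc n) * k) mod int p, s) = f (g ((int n * k) mod int p, s))"
      using gn[of "Suc n"] gn[of n] by simp
    also have "\<dots> = dihedral_rot p (f ((int n * k) mod int p, s))" by (rule conj[OF mem])
    finally show ?case using Suc by simp
  qed (simp add: ct)
  define e :: int where "e = (if t then - 1 else 1)"
  have fn': "f ((int n * k) mod int p, s) = ((c + e * int n) mod int p, t)" for n
    using fn[of n] dihedral_rot_funpow[OF p0, of c t n] ctV by (simp add: e_def V_def)
  have "\<not> int p dvd k"
  proof
    assume "int p dvd k"
    then have "f (0, s) = ((c + e) mod int p, t)" using fn'[of 1] by (simp add: mod_eq_0_iff_dvd)
    then have "(c + e) mod int p = c mod int p" using ct ctV by (simp add: V)
    then have "int p dvd e" by (simp add: mod_eq_dvd_iff)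
    then show False using p1 by (auto simp: e_def split: if_splits)
  qed
  then have "coprime k (int p)"
    using p by (meson coprime_commute prime_imp_coprime prime_nat_int_transfer)
  then obtain l where l: "[k * l = 1] (mod int p)" using cong_solve_coprime_int by blast
  have cl: "coprime l (int p)"
    using l coprime_iff_invertible_int by (metis mult.commute)
  have "f (b, s) = ((c + (e * l) * b) mod int p, t)" if b: "b \<in> {0..<int p}" for b
  proof -
    \<comment> \<open>The number of steps of length \<open>k\<close> from 0 to \<open>b\<close>, as
      \<open>l\<close> inverts \<open>k\<close>.\<close>
    define n where "n = nat ((b * l) mod int p)"
    have n: "int n = (b * l) mod int p" using p0 by (simp add: n_def)
    have "(int n * k) mod int p = (b * (k * l)) mod int p"
      by (simp add: n mod_simps ac_simps)
    also have "\<dots> = b"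
      using cong_scalar_left[OF l, of b] b by (simp add: cong_def)
    finally have "f (b, s) = ((c + e * int n) mod int p, t)" using fn'[of n] by simp
    also have "(c + e * int n) mod int p = (c + (e * l) * b) mod int p"
      using mod_affine_mod[of e "b * l" "int p" c] by (simp add: n add.commute ac_simps)
    finally show ?thesis .
  qed
  moreover have "coprime (e * l) (int p)" using cl by (simp add: e_def)
  ultimately show ?thesis by blast
qed

text \<open>With an automorphism \<open>k\<close> of the first graph that conjugates
  \<open>q\<close> into the Sylow subgroup of the rotation, take \<open>h\<close> to be
  \<open>f\<close> after the inverse of \<open>k\<close>, and \<open>g\<close> the conjugate of
  \<open>q\<close> by \<open>k\<close>. Then \<open>h\<close> is still an isomorphism, and the
  factors \<open>k\<close> cancel in \<open>h \<circ> g\<close>.\<close>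

lemma cayley_iso_conjugates_rotation:
  fixes p :: nat
  defines "D \<equiv> dihedral_group p"
  defines "V \<equiv> carrier D"
  assumes p: "prime p" "odd p"
    and f: "bij_betw f V V"
    and iso: "\<And>x y. x \<in> V \<Longrightarrow> y \<in> V \<Longrightarrow>
      y \<otimes>\<^bsub>D\<^esub> inv\<^bsub>D\<^esub> x \<in> S \<longleftrightarrow> f y \<otimes>\<^bsub>D\<^esub> inv\<^bsub>D\<^esub> (f x) \<in> T"
  obtains h g where "bij_betw h V V"
    "\<And>x y. x \<in> V \<Longrightarrow> y \<in> V \<Longrightarrow>
      y \<otimes>\<^bsub>D\<^esub> inv\<^bsub>D\<^esub> x \<in> S \<longleftrightarrow> h y \<otimes>\<^bsub>D\<^esub> inv\<^bsub>D\<^esub> (h x) \<in> T"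
    "\<And>s. \<exists>k. \<forall>b\<in>{0..<int p}. g (b, s) = ((b + k) mod int p, s)"
    "\<And>x. x \<in> V \<Longrightarrow> h (g x) = dihedral_rot p (h x)"
proof -
  have p0: "p > 0" using p prime_gt_0_nat by blast
  interpret D: group D unfolding D_def by (rule group_dihedral_group[OF p0])
  interpret B: group "BijGroup V" by (rule group_BijGroup)
  have fin: "finite V" by (simp add: V_def D_def carrier_dihedral_group)
  let ?r = "dihedral_rot p"
  define E where "E = (\<lambda>x y. y \<otimes>\<^bsub>D\<^esub> inv\<^bsub>D\<^esub> x \<in> S)"
  define F where "F = (\<lambda>x y. y \<otimes>\<^bsub>D\<^esub> inv\<^bsub>D\<^esub> x \<in> T)"
  have EF: "E x y \<longleftrightarrow> F (f x) (f y)" if "x \<in> V" "y \<in> V" for x y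
    using iso[OF that] by (simp add: E_def F_def)
  have rB: "?r \<in> Bij V" unfolding V_def D_def by (rule dihedral_rot_Bij[OF p0])
  have tau: "dihedral_tau p \<in> V" unfolding V_def D_def by (rule dihedral_relations(1)[OF p0])
  have quot: "?r y \<otimes>\<^bsub>D\<^esub> inv\<^bsub>D\<^esub> (?r x) = y \<otimes>\<^bsub>D\<^esub> inv\<^bsub>D\<^esub> x" if "x \<in> V" "y \<in> V" for x y
    using D.right_mult_quotient[of x y "dihedral_tau p"] that tau dihedral_rot_eq[OF p0]
    by (simp add: V_def D_def)
  have rper: "(?r ^^ p) x = x" if "x \<in> V" for x
    using that dihedral_rot_funpow[OF p0, of "fst x" "snd x" p]
    by (cases x) (auto simp: V_def D_def carrier_dihedral_group)
  \<comment> \<open>The rotation of the target graph pulled back along \<open>f\<close>: an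
    automorphism of the source graph of period \<open>p\<close>, in general unrelated to the
    rotation there.\<close>
  define q where "q = (\<lambda>x\<in>V. inv_into V f (?r (f x)))"
  have fV: "f x \<in> V" if "x \<in> V" for x using bij_betwE[OF f] that by blast
  have rV: "?r x \<in> V" if "x \<in> V" for x by (rule Bij_apply_closed[OF rB that])
  have fq: "f (q x) = ?r (f x)" "q x \<in> V" if "x \<in> V" for x
    using bij_betw_inv_into_right[OF f rV[OF fV[OF that]]] that rV[OF fV[OF that]]
      bij_betwE[OF bij_betw_inv_into[OF f]] by (simp_all add: q_def)
  have qB: "q \<in> Bij V"
  proof -
    have "bij_betw ?r V V" using rB by (simp add: Bij_def)
    then have "bij_betw (inv_into V f \<circ> (?r \<circ> f)) V V"
      using f by (intro bij_betw_trans[OF bij_betw_trans] bij_betw_inv_into) auto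
    then have "bij_betw q V V" by (rule bij_betw_cong[THEN iffD1, rotated]) (simp add: q_def)
    then show ?thesis by (simp add: Bij_def q_def)
  qed
  let ?A = "rel_auto V E"
  let ?G = "BijGroup V \<lparr>carrier := ?A\<rparr>"
  have sA: "subgroup ?A (BijGroup V)" by (rule subgroup_rel_auto)
  interpret G: group ?G by (rule B.subgroup_imp_group[OF sA])
  have rA: "?r \<in> ?A" using rB quot by (auto simp: rel_auto_def E_def)
  have "E (q x) (q y) \<longleftrightarrow> E x y" if "x \<in> V" "y \<in> V" for x y
    using EF[OF fq(2)[OF that(1)] fq(2)[OF that(2)]] EF[OF that] quot[OF fV[OF that(1)] fV[OF that(2)]]
    by (simp add: F_def fq(1) that)
  then have qA: "q \<in> ?A" using qB by (simp add: rel_auto_def)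
  have pow1: "g [^]\<^bsub>?G\<^esub> p = \<one>\<^bsub>?G\<^esub>" if gA: "g \<in> ?A" and per: "\<And>x. x \<in> V \<Longrightarrow> (g ^^ p) x = x" for g
  proof -
    have gB: "g \<in> Bij V" using gA by (simp add: rel_auto_def)
    have "g [^]\<^bsub>BijGroup V\<^esub> p = \<one>\<^bsub>BijGroup V\<^esub>"
    proof (rule Bij_eqI)
      show "g [^]\<^bsub>BijGroup V\<^esub> p \<in> Bij V" "\<one>\<^bsub>BijGroup V\<^esub> \<in> Bij V"
        using gB B.nat_pow_closed[of g p] B.one_closed by (simp_all add: carrier_BijGroup)
      show "(g [^]\<^bsub>BijGroup V\<^esub> p) x = \<one>\<^bsub>BijGroup V\<^esub> x" if "x \<in> V" for x
        using BijGroup_pow_apply[OF gB that] per[OF that] BijGroup_one_apply[OF that] by simp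
    qed
    then show ?thesis by (simp flip: B.nat_pow_consistent)
  qed
  have fqn: "(q ^^ n) x \<in> V \<and> f ((q ^^ n) x) = (?r ^^ n) (f x)" if "x \<in> V" for x n
    by (induction n) (use that fq in auto)
  have qper: "(q ^^ p) x = x" if "x \<in> V" for x
  proof -
    have "f ((q ^^ p) x) = f x" using fqn[OF that] rper[OF fV[OF that]] by simp
    then show ?thesis using f fqn[OF that] that by (auto simp: bij_betw_def inj_on_def)
  qed
  have finG: "finite (carrier ?G)"
    using finite_subset[OF subgroup.subset[OF sA]] finite_Bij[OF fin] by (simp add: carrier_BijGroup)
  have rG: "?r \<in> carrier ?G" using rA by simp
  obtain P a where P: "subgroup P ?G" "card P = p ^ a" "?r \<in> P"
    and conj: "\<And>q. q \<in> carrier ?G \<Longrightarrow> q [^]\<^bsub>?G\<^esub> p = \<one>\<^bsub>?G\<^esub> \<Longrightarrow>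
      \<exists>g\<in>carrier ?G. g \<otimes>\<^bsub>?G\<^esub> q \<otimes>\<^bsub>?G\<^esub> inv\<^bsub>?G\<^esub> g \<in> P"
    using G.sylow_subgroup_conjugates[OF finG p(1) rG pow1[OF rA rper]] by blast
  have PB: "subgroup P (BijGroup V)" by (rule B.incl_subgroup[OF sA P(1)])
  obtain k where k: "k \<in> ?A" "k \<otimes>\<^bsub>?G\<^esub> q \<otimes>\<^bsub>?G\<^esub> inv\<^bsub>?G\<^esub> k \<in> P"
    using conj[OF _ pow1[OF qA qper]] qA by auto
  have kB: "k \<in> Bij V" using k by (simp add: rel_auto_def)
  define ki where "ki = inv\<^bsub>BijGroup V\<^esub> k"
  have kiA: "ki \<in> ?A" unfolding ki_def by (rule subgroup.m_inv_closed[OF sA k(1)])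
  then have kiB: "ki \<in> Bij V" by (simp add: rel_auto_def)
  define g where "g = k \<otimes>\<^bsub>BijGroup V\<^esub> q \<otimes>\<^bsub>BijGroup V\<^esub> ki"
  have gP: "g \<in> P"
    using k(2) B.m_inv_consistent[OF sA k(1)] by (simp add: g_def ki_def)
  have kqB: "k \<otimes>\<^bsub>BijGroup V\<^esub> q \<in> Bij V"
    using B.m_closed[of k q] kB qB by (simp add: carrier_BijGroup)
  have kiV: "ki x \<in> V" if "x \<in> V" for x by (rule Bij_apply_closed[OF kiB that])
  have gx: "g x = k (q (ki x))" if "x \<in> V" for x
    unfolding g_def using BijGroup_mult_apply[OF kqB kiB that] BijGroup_mult_apply[OF kB qB kiV[OF that]]
    by simp
  show thesis
  proof (rule that[of "f \<circ> ki" g])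
    have "bij_betw ki V V" using kiB by (simp add: Bij_def)
    then show "bij_betw (f \<circ> ki) V V" using f by (rule bij_betw_trans)
    show "\<exists>k. \<forall>b\<in>{0..<int p}. g (b, s) = ((b + k) mod int p, s)" for s
      using p_group_acts_by_translations[OF p, of P a g s] PB P gP by (simp add: V_def D_def)
    fix x assume x: "x \<in> V"
    have "ki (k y) = y" if "y \<in> V" for y
      unfolding ki_def by (rule BijGroup_inv_apply(3)[OF kB that])
    then show "(f \<circ> ki) (g x) = ?r ((f \<circ> ki) x)"
      using gx[OF x] fq[OF kiV[OF x]] by simp
    fix y assume y: "y \<in> V"
    have "E (ki x) (ki y) \<longleftrightarrow> E x y" using kiA x y by (simp add: rel_auto_def)
    then show "y \<otimes>\<^bsub>D\<^esub> inv\<^bsub>D\<^esub> x \<in> S \<longleftrightarrow> (f \<circ> ki) y \<otimes>\<^bsub>D\<^esub> inv\<^bsub>D\<^esub> ((f \<circ> ki) x) \<in> T"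
      using EF[OF kiV[OF x] kiV[OF y]] by (simp add: E_def F_def)
  qed
qed

text \<open>
  Babai's theorem that the dihedral group of order \<open>2p\<close> is a CI-group. Once the isomorphism is affine
  on the rotations, the neighbourhoods of \<open>(0, False)\<close> and of \<open>(0, True)\<close> among the rotations
  already determine the two halves of the connection set.
\<close>

theorem dihedral_cayley_isomorphism:
  fixes p :: nat
  defines "D \<equiv> dihedral_group p"
  defines "V \<equiv> carrier D"
  assumes p: "prime p" "odd p"
    and ST: "S \<subseteq> V" "T \<subseteq> V"
    and f: "bij_betw f V V"
    and iso: "\<And>x y. x \<in> V \<Longrightarrow> y \<in> V \<Longrightarrow>
      y \<otimes>\<^bsub>D\<^esub> inv\<^bsub>D\<^esub> x \<in> S \<longleftrightarrow> f y \<otimes>\<^bsub>D\<^esub> inv\<^bsub>D\<^esub> (f x) \<in> T"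
  shows "\<exists>u v. coprime u (int p) \<and> T = dihedral_affine p u v ` S"
proof -
  have p0: "p > 0" using p prime_gt_0_nat by blast
  have V: "(b, t) \<in> V \<longleftrightarrow> b \<in> {0..<int p}" for b t
    by (simp add: V_def D_def carrier_dihedral_group)
  obtain h g where h: "bij_betw h V V"
    and hiso: "\<And>x y. x \<in> V \<Longrightarrow> y \<in> V \<Longrightarrow>
      y \<otimes>\<^bsub>D\<^esub> inv\<^bsub>D\<^esub> x \<in> S \<longleftrightarrow> h y \<otimes>\<^bsub>D\<^esub> inv\<^bsub>D\<^esub> (h x) \<in> T"
    and g: "\<And>s. \<exists>k. \<forall>b\<in>{0..<int p}. g (b, s) = ((b + k) mod int p, s)"
    and hg: "\<And>x. x \<in> V \<Longrightarrow> h (g x) = dihedral_rot p (h x)"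
    using cayley_iso_conjugates_rotation[OF p, of f S T] f iso unfolding V_def D_def by blast
  have "\<exists>c t u. coprime u (int p) \<and> (\<forall>b\<in>{0..<int p}. h (b, s) = ((c + u * b) mod int p, t))" for s
  proof -
    obtain k where "\<And>b. b \<in> {0..<int p} \<Longrightarrow> g (b, s) = ((b + k) mod int p, s)" using g by blast
    then show ?thesis
      using bij_affine_of_conjugated_rotation[OF p(1), of h g s k] h hg unfolding V_def D_def by blast
  qed
  then obtain c t u where u: "\<And>s. coprime (u s) (int p)"
    and hs: "\<And>s b. b \<in> {0..<int p} \<Longrightarrow> h (b, s) = ((c s + u s * b) mod int p, t s)"
    by metis
  have tne: "t False \<noteq> t True"
  proof
    assume eq: "t False = t True"
    have "(0, \<not> t True) \<in> h ` V" using h p0 by (simp add: bij_betw_def V)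
    then obtain b s where "(b, s) \<in> V" "h (b, s) = (0, \<not> t True)" by auto
    then have "t s = (\<not> t True)" using hs[of b s] by (simp add: V)
    with eq show False by (cases s) auto
  qed
  note q = dihedral_quotient[OF p0, folded D_def, folded V_def]
  have rot: "(b, False) \<in> S \<longleftrightarrow> ((u False * b) mod int p, False) \<in> T" if b: "b \<in> {0..<int p}" for b
  proof -
    have z: "(0::int) \<in> {0..<int p}" using p0 by simp
    have m: "(x mod int p, w) \<in> V" for x w using p0 by (simp add: V)
    have "(b, False) \<in> S \<longleftrightarrow> (b, False) \<otimes>\<^bsub>D\<^esub> inv\<^bsub>D\<^esub> (0, False) \<in> S"
      using q[of 0 False b False] b z by (simp add: V)
    also have "\<dots> \<longleftrightarrow> h (b, False) \<otimes>\<^bsub>D\<^esub> inv\<^bsub>D\<^esub> (h (0, False)) \<in> T"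
      by (rule hiso) (use b z in \<open>simp_all add: V\<close>)
    also have "h (b, False) \<otimes>\<^bsub>D\<^esub> inv\<^bsub>D\<^esub> (h (0, False)) = ((u False * b) mod int p, False)"
      using q[OF m m] hs[OF b] hs[OF z] by (simp add: mod_simps)
    finally show ?thesis .
  qed
  have refl: "(b, True) \<in> S \<longleftrightarrow> ((u False * b + (c False + c True)) mod int p, True) \<in> T"
    if b: "b \<in> {0..<int p}" for b
  proof -
    have z: "(0::int) \<in> {0..<int p}" using p0 by simp
    have m: "(x mod int p, w) \<in> V" for x w using p0 by (simp add: V)
    \<comment> \<open>On the reflections only \<open>h (0, True)\<close> is evaluated, so both
      halves of \<open>S\<close> receive the same slope \<open>u False\<close>. Labels add across
      types, hence the offset \<open>c False + c True\<close>.\<close>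
    have "(b, True) \<in> S \<longleftrightarrow> (0, True) \<otimes>\<^bsub>D\<^esub> inv\<^bsub>D\<^esub> (b, False) \<in> S"
      using q[of b False 0 True] b z by (simp add: V)
    also have "\<dots> \<longleftrightarrow> h (0, True) \<otimes>\<^bsub>D\<^esub> inv\<^bsub>D\<^esub> (h (b, False)) \<in> T"
      by (rule hiso) (use b z in \<open>simp_all add: V\<close>)
    also have "h (0, True) \<otimes>\<^bsub>D\<^esub> inv\<^bsub>D\<^esub> (h (b, False))
        = ((c False + u False * b + c True) mod int p, True)"
      using q[OF m m] hs[OF z] hs[OF b] tne by (simp add: mod_simps)
    finally show ?thesis by (simp add: add_ac)
  qed
  have "T = dihedral_affine p (u False) (c False + c True) ` S"
  proof -
    let ?v = "c False + c True"
    let ?a = "dihedral_affine p (u False) ?v"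
    have bij: "bij_betw ?a V V"
      using dihedral_affine_Bij[OF p0 u] by (simp add: V_def D_def Bij_def)
    have mem: "x \<in> S \<longleftrightarrow> ?a x \<in> T" if "x \<in> V" for x
    proof (cases x)
      case (Pair b s)
      with that have b: "b \<in> {0..<int p}" by (simp add: V)
      have "?a (b, s) = ((u False * b + (if s then ?v else 0)) mod int p, s)"
        by (rule dihedral_affine_apply) (use Pair that in \<open>simp add: V_def D_def\<close>)
      then show ?thesis using Pair rot[OF b] refl[OF b] by (cases s) simp_all
    qed
    show ?thesis
    proof (intro equalityI subsetI)
      fix y assume y: "y \<in> T"
      then have "y \<in> ?a ` V" using bij ST(2) by (auto simp: bij_betw_def)
      then obtain x where "x \<in> V" "y = ?a x" by blast
      with mem[of x] y show "y \<in> ?a ` S" by simp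
    next
      fix y assume "y \<in> ?a ` S"
      then obtain x where x: "x \<in> S" "y = ?a x" by blast
      then have "x \<in> V" using ST(1) by (rule_tac subsetD)
      with mem[of x] x show "y \<in> T" by simp
    qed
  qed
  with u show ?thesis by blast
qed

section \<open>Connectedness\<close>

text \<open>The library defines connectedness by strong connectedness of the symmetrised graph; here
  the arcs are already symmetric, so symmetrising changes nothing.\<close>

lemma connected_iff_rtrancl:
  assumes "pair_graph G"
  shows "Digraph_Component.connected (with_proj G) \<longleftrightarrow>
    pverts G \<noteq> {} \<and> (\<forall>u\<in>pverts G. \<forall>v\<in>pverts G. (u, v) \<in> (parcs G)\<^sup>*)"
proof -
  interpret pair_graph G by fact
  have sym: "(v, u) \<in> parcs G" if "(u, v) \<in> parcs G" for u v
    using that sym_arcs by (auto simp: symmetric_def sym_def)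
  have "parcs (mk_symmetric (with_proj G)) = parcs G"
    using sym by (auto simp: mk_symmetric_def)
  then have mk: "mk_symmetric (with_proj G) = G" by (simp add: mk_symmetric_def)
  have "u \<rightarrow>\<^sup>*\<^bsub>with_proj G\<^esub> v \<longleftrightarrow> (u, v) \<in> (parcs G)\<^sup>*" if u: "u \<in> pverts G" for u v
  proof
    assume "u \<rightarrow>\<^sup>*\<^bsub>with_proj G\<^esub> v"
    then show "(u, v) \<in> (parcs G)\<^sup>*" using reachable_rtranclI by fastforce
  next
    assume "(u, v) \<in> (parcs G)\<^sup>*"
    then show "u \<rightarrow>\<^sup>*\<^bsub>with_proj G\<^esub> v"
    proof (induction rule: rtrancl_induct)
      case base
      then show ?case using u reachable_refl by simp
    next
      case (step y z)
      then show ?case using reachable_adj_trans by simp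
    qed
  qed
  then show ?thesis
    unfolding Digraph_Component.connected_def mk strongly_connected_def by auto
qed

text \<open>Without reflections the type never changes along a path; a lone reflection gives a
  perfect matching. Otherwise some nonzero shift of the rotations is a path, from a rotation in
  \<open>S\<close> or from two distinct reflections used in turn. As \<open>p\<close> is prime, this
  shift reaches all rotations, and a reflection in \<open>S\<close> links the two types.\<close>

lemma dihedral_cayley_connected_iff:
  fixes p :: nat
  defines "D \<equiv> dihedral_group p"
  assumes p: "prime p" "odd p" and S: "cayley_set D S"
  shows "Digraph_Component.connected (with_proj (cayley_graph D S)) \<longleftrightarrow>
    (\<exists>b. (b, True) \<in> S) \<and> (\<forall>b. S \<noteq> {(b, True)})" (is "?L \<longleftrightarrow> ?R")
proof -
  have p0: "p > 0" and p1: "int p > 1" using prime_gt_1_nat[OF p(1)] by simp_all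
  interpret D: group D unfolding D_def by (rule group_dihedral_group[OF p0])
  have V: "(b, t) \<in> carrier D \<longleftrightarrow> b \<in> {0..<int p}" for b t
    by (simp add: D_def carrier_dihedral_group)
  have fin: "finite (carrier D)" by (simp add: D_def carrier_dihedral_group)
  have SV: "S \<subseteq> carrier D" using S by (simp add: cayley_set_def)
  let ?E = "parcs (cayley_graph D S)"
  have verts: "pverts (cayley_graph D S) = carrier D" by (simp add: cayley_graph_def)
  have pg: "pair_graph (cayley_graph D S)" by (rule pair_graph_cayley_graph[OF D.is_group fin S])
  have conn: "?L \<longleftrightarrow> (\<forall>u\<in>carrier D. \<forall>v\<in>carrier D. (u, v) \<in> ?E\<^sup>*)"
    unfolding connected_iff_rtrancl[OF pg] verts using D.one_closed by blast
  have E: "((a, s), (b, t)) \<in> ?E \<longleftrightarrow> a \<in> {0..<int p} \<and> b \<in> {0..<int p} \<and>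
      ((if s = t then b - a else a + b) mod int p, s \<noteq> t) \<in> S" for a s b t
    using dihedral_quotient[OF p0, of a s b t] by (auto simp: cayley_graph_def V D_def carrier_dihedral_group)
  show ?thesis
  proof
    assume ?L
    then have all: "(u, v) \<in> ?E\<^sup>*" if "u \<in> carrier D" "v \<in> carrier D" for u v
      using conn that by blast
    show ?R
    proof (intro conjI allI)
      show "\<exists>b. (b, True) \<in> S"
      proof (rule ccontr)
        assume no: "\<not> (\<exists>b. (b, True) \<in> S)"
        have "snd v = False" if "((0, False), v) \<in> ?E\<^sup>*" for v
          using that
        proof (induction rule: rtrancl_induct)
          case (step y z)
          obtain a s c t where "y = (a, s)" "z = (c, t)" by (cases y; cases z)
          then show ?case using step no E[of a s c t] by (auto split: if_splits)
        qed simp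
        from this[OF all[of "(0, False)" "(0, True)"]] show False using p0 by (simp add: V)
      qed
      show "S \<noteq> {(b, True)}" for b
      proof
        assume Sb: "S = {(b, True)}"
        then have b: "b \<in> {0..<int p}" using SV by (simp add: V)
        have "v \<in> {(0, False), (b, True)}" if "((0, False), v) \<in> ?E\<^sup>*" for v
          using that
        proof (induction rule: rtrancl_induct)
          case (step y z)
          obtain c t where z: "z = (c, t)" by (cases z)
          from step.IH consider "y = (0, False)" | "y = (b, True)" by blast
          then show ?case
          proof cases
            case 1
            then show ?thesis using step.hyps(2) E[of 0 False c t] Sb z b by (auto split: if_splits)
          next
            case 2
            then have "t = False" "(b + c) mod int p = b" "c \<in> {0..<int p}"
              using step.hyps(2) E[of b True c t] Sb z by (auto split: if_splits)
            then have "(b + c) mod int p = b mod int p" "c \<in> {0..<int p}" using b by simp_all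
            then have "int p dvd c" by (simp add: mod_eq_dvd_iff)
            then have "c = 0" using \<open>c \<in> {0..<int p}\<close> zdvd_not_zless[of c "int p"] by force
            then show ?thesis using z \<open>t = False\<close> by simp
          qed
        qed simp
        from this[OF all[of "(0, False)" "(1, False)"]] show False using p1 by (simp add: V)
      qed
    qed
  next
    assume R: ?R
    then obtain b where b: "(b, True) \<in> S" by blast
    have bp: "b \<in> {0..<int p}" using b SV V by blast
    have symE: "(v, u) \<in> ?E\<^sup>*" if "(u, v) \<in> ?E\<^sup>*" for u v
    proof -
      interpret pair_graph "cayley_graph D S" by (rule pg)
      have "sym ?E" using sym_arcs by (auto simp: symmetric_def)
      then show ?thesis using that by (metis sym_rtrancl symD)
    qed
    have cross: "((x, s), ((b - x) mod int p, \<not> s)) \<in> ?E\<^sup>*" if "x \<in> {0..<int p}" for x s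
      by (rule r_into_rtrancl) (use that b bp p0 in \<open>simp add: E mod_simps\<close>)
    have "\<exists>a. \<not> int p dvd a \<and> (\<forall>x\<in>{0..<int p}. ((x, False), ((x + a) mod int p, False)) \<in> ?E\<^sup>*)"
    proof (cases "\<exists>a. (a, False) \<in> S")
      case True
      then obtain a where a: "(a, False) \<in> S" by blast
      have "a \<in> {0..<int p}" "a \<noteq> 0"
        using a SV V S D.one_closed by (auto simp: cayley_set_def D_def dihedral_one)
      then have "\<not> int p dvd a" using zdvd_not_zless[of a "int p"] by force
      moreover have "((x, False), ((x + a) mod int p, False)) \<in> ?E\<^sup>*" if "x \<in> {0..<int p}" for x
        by (rule r_into_rtrancl) (use that a \<open>a \<in> {0..<int p}\<close> p0 in \<open>simp add: E mod_simps\<close>)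
      ultimately show ?thesis by blast
    next
      case False
      have "\<exists>c. (c, True) \<in> S \<and> c \<noteq> b"
      proof (rule ccontr)
        assume no: "\<not> (\<exists>c. (c, True) \<in> S \<and> c \<noteq> b)"
        have "x = (b, True)" if "x \<in> S" for x
          using that no False by (cases x; cases "snd x") auto
        then have "S = {(b, True)}" using b by blast
        with R show False by blast
      qed
      then obtain c where c: "(c, True) \<in> S" "c \<noteq> b" by blast
      have cp: "c \<in> {0..<int p}" using c SV V by blast
      have "\<not> int p dvd c - b"
      proof
        assume "int p dvd c - b"
        then have "c mod int p = b mod int p" by (simp add: mod_eq_dvd_iff)
        then show False using c cp bp by simp
      qed
      moreover have "((x, False), ((x + (c - b)) mod int p, False)) \<in> ?E\<^sup>*" if x: "x \<in> {0..<int p}" for x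
      proof -
        \<comment> \<open>Crossing over with the reflection \<open>b\<close> and back with
          \<open>c\<close> shifts \<open>x\<close> by \<open>c - b\<close>.\<close>
        have "(((b - x) mod int p, True), ((x + (c - b)) mod int p, False)) \<in> ?E"
          using c cp p0 by (simp add: E mod_simps)
        then show ?thesis using cross[OF x, of False] by simp
      qed
      ultimately show ?thesis by blast
    qed
    then obtain a where a: "\<not> int p dvd a"
      and step: "\<And>x. x \<in> {0..<int p} \<Longrightarrow> ((x, False), ((x + a) mod int p, False)) \<in> ?E\<^sup>*" by blast
    have steps: "((0, False), ((int n * a) mod int p, False)) \<in> ?E\<^sup>*" for n
    proof (induction n)
      case (Suc n)
      have "(((int n * a) mod int p, False), (((int n * a) mod int p + a) mod int p, False)) \<in> ?E\<^sup>*"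
        by (rule step) (use p0 in simp)
      moreover have "((int n * a) mod int p + a) mod int p = (int (Suc n) * a) mod int p"
        by (simp add: mod_simps algebra_simps)
      ultimately show ?case using Suc by (metis rtrancl_trans)
    qed simp
    have "coprime a (int p)"
      using a p(1) by (meson coprime_commute prime_imp_coprime prime_nat_int_transfer)
    then obtain l where l: "[a * l = 1] (mod int p)" using cong_solve_coprime_int by blast
    have level: "((0, False), (x, False)) \<in> ?E\<^sup>*" if x: "x \<in> {0..<int p}" for x
    proof -
      define n where "n = nat ((x * l) mod int p)"
      have "(int n * a) mod int p = (x * (a * l)) mod int p"
        using p0 by (simp add: n_def mod_simps ac_simps)
      also have "\<dots> = x" using cong_scalar_left[OF l, of x] x by (simp add: cong_def)
      finally show ?thesis using steps[of n] by simp
    qed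
    have reach: "((0, False), v) \<in> ?E\<^sup>*" if v: "v \<in> carrier D" for v
    proof (cases v)
      case (Pair x s)
      then have x: "x \<in> {0..<int p}" using v V by simp
      show ?thesis
      proof (cases s)
        case True
        have "((0, False), ((b - x) mod int p, False)) \<in> ?E\<^sup>*" by (rule level) (use p0 in simp)
        moreover have "(((b - x) mod int p, False), (x, True)) \<in> ?E\<^sup>*"
          using symE[OF cross[OF x, of True]] True by simp
        ultimately have "((0, False), (x, True)) \<in> ?E\<^sup>*" by (rule rtrancl_trans)
        then show ?thesis using True Pair by simp
      qed (use level[OF x] Pair in simp)
    qed
    have "(u, v) \<in> ?E\<^sup>*" if "u \<in> carrier D" "v \<in> carrier D" for u v
      using rtrancl_trans[OF symE[OF reach[OF that(1)]] reach[OF that(2)]] .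
    then show ?L using conn by blast
  qed
qed

section \<open>Reduction to orbits of the automorphism group\<close>

text \<open>For \<open>n > 2\<close> the generator \<open>(1, False)\<close> is not an involution,
  so its image is a rotation; surjectivity then forces \<open>(0, True)\<close> to go to a
  reflection and \<open>u\<close> to be invertible. For \<open>n = 2\<close>, the Klein four-group,
  there are further automorphisms. Identifying the affine maps with \<open>auto\<close> supplies
  their group structure.\<close>

lemma auto_dihedral_group:
  assumes p: "n > 2"
  shows "auto (dihedral_group n) = {dihedral_affine n u v | u v. coprime u (int n)}"
proof (intro equalityI subsetI)
  fix f assume f: "f \<in> auto (dihedral_group n)"
  have n0: "n > 0" using p by simp
  let ?D = "dihedral_group n"
  interpret D: group ?D by (rule group_dihedral_group[OF n0])
  have hom: "f \<in> hom ?D ?D" and fB: "f \<in> Bij (carrier ?D)" using f by (auto simp: auto_def)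
  have V: "(b, t) \<in> carrier ?D \<longleftrightarrow> b \<in> {0..<int n}" for b t
    by (simp add: carrier_dihedral_group)
  have mult: "f (x \<otimes>\<^bsub>?D\<^esub> y) = f x \<otimes>\<^bsub>?D\<^esub> f y" if "x \<in> carrier ?D" "y \<in> carrier ?D" for x y
    using hom that by (simp add: hom_def)
  have one: "f (0, False) = (0, False)" using Group.hom_one[OF hom D.is_group D.is_group] by (simp add: dihedral_one)
  obtain u s where us: "f (1, False) = (u, s)" by (cases "f (1, False)")
  obtain v t where vt: "f (0, True) = (v, t)" by (cases "f (0, True)")
  have tau: "(1, False) \<in> carrier ?D" and sig: "(0, True) \<in> carrier ?D" using p by (simp_all add: V)
  have "\<not> s"
  proof
    assume s
    have "f ((1, False) \<otimes>\<^bsub>?D\<^esub> (1, False)) = f (0, False)"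
      using mult[OF tau tau] us one \<open>s\<close> by (simp add: dihedral_mult)
    moreover have "(1, False) \<otimes>\<^bsub>?D\<^esub> (1, False) = (2, False)" using p by (simp add: dihedral_mult)
    ultimately show False
      using Bij_apply_eq_iff[OF fB, of "(2, False)" "(0, False)"] p by (simp add: V)
  qed
  with us have us: "f (1, False) = (u, False)" by simp
  have rot: "f (int k mod int n, False) = ((u * int k) mod int n, False)" for k
  proof (induction k)
    case (Suc k)
    have "(int (Suc k) mod int n, False) = (int k mod int n, False) \<otimes>\<^bsub>?D\<^esub> (1, False)"
      by (simp add: dihedral_mult mod_simps add.commute)
    moreover have "(int k mod int n, False) \<in> carrier ?D" using n0 by (simp add: V)
    ultimately have "f (int (Suc k) mod int n, False) = f (int k mod int n, False) \<otimes>\<^bsub>?D\<^esub> f (1, False)"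
      using mult tau by metis
    then show ?case using Suc us by (simp add: dihedral_mult mod_simps algebra_simps)
  qed (simp add: one)
  have rot': "f (a, False) = ((u * a) mod int n, False)" if "a \<in> {0..<int n}" for a
    using rot[of "nat a"] that by simp
  have refl': "f (a, True) = ((u * a + v) mod int n, t)" if a: "a \<in> {0..<int n}" for a
  proof -
    have "(a, True) = (a, False) \<otimes>\<^bsub>?D\<^esub> (0, True)" using a by (simp add: dihedral_mult)
    then have "f (a, True) = f (a, False) \<otimes>\<^bsub>?D\<^esub> f (0, True)"
      using mult[of "(a, False)" "(0, True)"] a sig by (simp add: V)
    then show ?thesis using rot'[OF a] vt by (simp add: dihedral_mult mod_simps)
  qed
  have img: "f ` carrier ?D = carrier ?D" using fB by (simp add: Bij_def bij_betw_def)
  have t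
  proof (rule ccontr)
    assume "\<not> t"
    have "(0, True) \<in> f ` carrier ?D" using sig img by simp
    then obtain x where x: "x \<in> carrier ?D" "f x = (0, True)" by auto
    show False
    proof (cases x)
      case (Pair a w)
      then show False using x rot'[of a] refl'[of a] \<open>\<not> t\<close> by (cases w) (simp_all add: V)
    qed
  qed
  have "f = dihedral_affine n u v"
  proof (rule extensionalityI)
    show "f \<in> extensional (carrier ?D)" using fB by (rule Bij_imp_extensional)
    show "dihedral_affine n u v \<in> extensional (carrier ?D)" by (simp add: dihedral_affine_def)
    fix x assume x: "x \<in> carrier ?D"
    show "f x = dihedral_affine n u v x"
    proof (cases x)
      case (Pair a w)
      then have a: "a \<in> {0..<int n}" using x by (simp add: V)
      show ?thesis
        using Pair rot'[OF a] refl'[OF a] \<open>t\<close> dihedral_affine_apply[of a w n u v] a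
        by (cases w) (simp_all add: V)
    qed
  qed
  moreover have "coprime u (int n)"
  proof -
    have "(1, False) \<in> f ` carrier ?D" using tau img by simp
    then obtain x where x: "x \<in> carrier ?D" "f x = (1, False)" by auto
    obtain a w where aw: "x = (a, w)" by (cases x)
    have "\<not> w" using x aw refl'[of a] \<open>t\<close> by (auto simp: V)
    then have "(u * a) mod int n = 1" using x aw rot'[of a] by (simp add: V)
    then have "[u * a = 1] (mod int n)" using p by (simp add: cong_def)
    then show ?thesis using coprime_iff_invertible_int by blast
  qed
  ultimately show "f \<in> {dihedral_affine n u v | u v. coprime u (int n)}" by blast
next
  fix f assume "f \<in> {dihedral_affine n u v | u v. coprime u (int n)}"
  then show "f \<in> auto (dihedral_group n)" using dihedral_affine_auto p by auto
qed

lemma group_action_on_subsets: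
  assumes K: "subgroup K (BijGroup V)" and X: "X \<subseteq> Pow V"
    and cl: "\<And>f S. f \<in> K \<Longrightarrow> S \<in> X \<Longrightarrow> f ` S \<in> X"
  shows "group_action (BijGroup V \<lparr>carrier := K\<rparr>) X (\<lambda>f. \<lambda>S\<in>X. f ` S)"
proof -
  interpret B: group "BijGroup V" by (rule group_BijGroup)
  let ?G = "BijGroup V \<lparr>carrier := K\<rparr>" and ?a = "\<lambda>f. \<lambda>S\<in>X. f ` S"
  interpret G: group ?G by (rule B.subgroup_imp_group[OF K])
  interpret BX: group "BijGroup X" by (rule group_BijGroup)
  have KB: "f \<in> Bij V" if "f \<in> K" for f
    using subgroup.subset[OF K] that by (auto simp: carrier_BijGroup)
  have mult: "(f \<otimes>\<^bsub>BijGroup V\<^esub> g) ` S = f ` (g ` S)" if "f \<in> K" "g \<in> K" "S \<in> X" for f g S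
  proof -
    have SV: "S \<subseteq> V" using X that by blast
    have "(f \<otimes>\<^bsub>BijGroup V\<^esub> g) x = f (g x)" if "x \<in> S" for x
      by (rule BijGroup_mult_apply[OF KB[OF \<open>f \<in> K\<close>] KB[OF \<open>g \<in> K\<close>] subsetD[OF SV that]])
    then show ?thesis by (simp add: image_image)
  qed
  have one: "\<one>\<^bsub>BijGroup V\<^esub> ` S = S" if "S \<in> X" for S
  proof -
    have SV: "S \<subseteq> V" using X that by blast
    have "\<one>\<^bsub>BijGroup V\<^esub> x = x" if "x \<in> S" for x by (rule BijGroup_one_apply[OF subsetD[OF SV that]])
    then show ?thesis by simp
  qed
  have bij: "?a f \<in> Bij X" if f: "f \<in> K" for f
  proof -
    let ?i = "inv\<^bsub>BijGroup V\<^esub> f"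
    have i: "?i \<in> K" by (rule subgroup.m_inv_closed[OF K f])
    have fc: "f \<in> carrier (BijGroup V)" using KB[OF f] by (simp add: carrier_BijGroup)
    have "bij_betw (\<lambda>S. f ` S) X X"
    proof (rule bij_betwI[where g = "\<lambda>S. ?i ` S"])
      show "?i ` f ` S = S" if "S \<in> X" for S
        using mult[OF i f that] one[OF that] B.l_inv[OF fc] by simp
      show "f ` ?i ` S = S" if "S \<in> X" for S
        using mult[OF f i that] one[OF that] B.r_inv[OF fc] by simp
    qed (use cl f i in auto)
    then have "bij_betw (?a f) X X" by (rule bij_betw_cong[THEN iffD1, rotated]) simp
    then show ?thesis by (simp add: Bij_def)
  qed
  have "?a (f \<otimes>\<^bsub>BijGroup V\<^esub> g) = ?a f \<otimes>\<^bsub>BijGroup X\<^esub> ?a g" if f: "f \<in> K" and g: "g \<in> K" for f g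
  proof (rule Bij_eqI)
    show "?a (f \<otimes>\<^bsub>BijGroup V\<^esub> g) \<in> Bij X" by (rule bij[OF subgroup.m_closed[OF K f g]])
    show "?a f \<otimes>\<^bsub>BijGroup X\<^esub> ?a g \<in> Bij X"
      using BX.m_closed[of "?a f" "?a g"] bij[OF f] bij[OF g] by (simp add: carrier_BijGroup)
    show "?a (f \<otimes>\<^bsub>BijGroup V\<^esub> g) S = (?a f \<otimes>\<^bsub>BijGroup X\<^esub> ?a g) S" if "S \<in> X" for S
      using BijGroup_mult_apply[OF bij[OF f] bij[OF g] that] mult[OF f g that] cl[OF g that] that by simp
  qed
  then have "?a \<in> hom ?G (BijGroup X)" using bij by (auto simp: hom_def carrier_BijGroup)
  then show ?thesis
    by (simp add: group_action_def group_hom_def group_hom_axioms_def G.is_group BX.is_group)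
qed

lemma (in group) auto_preserves_quotient:
  assumes f: "f \<in> auto G" and "x \<in> carrier G" "y \<in> carrier G"
  shows "f y \<otimes> inv (f x) = f (y \<otimes> inv x)"
proof -
  interpret h: group_hom G G f
    using f by unfold_locales (simp add: auto_def)
  show ?thesis using assms by simp
qed

lemma (in group) cayley_set_image_auto:
  assumes f: "f \<in> auto G" and S: "cayley_set G S"
  shows "cayley_set G (f ` S)"
proof -
  interpret h: group_hom G G f
    using f by unfold_locales (simp add: auto_def)
  have sub: "S \<subseteq> carrier G" and inv: "m_inv G ` S = S" using S by (auto simp: cayley_set_def)
  have fB: "f \<in> Bij (carrier G)" using f by (simp add: auto_def)
  have "\<one> \<notin> f ` S"
  proof
    assume "\<one> \<in> f ` S"
    then obtain x where x: "x \<in> S" "f x = \<one>" by auto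
    then have "x = \<one>" using Bij_apply_eq_iff[OF fB, of x \<one>] sub by auto
    then show False using x S by (simp add: cayley_set_def)
  qed
  moreover have "m_inv G ` f ` S = f ` S"
  proof -
    have "m_inv G ` f ` S = f ` m_inv G ` S"
      unfolding image_image using sub by (intro image_cong) auto
    then show ?thesis by (simp add: inv)
  qed
  moreover have "f ` S \<subseteq> carrier G" using sub by auto
  ultimately show ?thesis by (simp add: cayley_set_def)
qed

definition connection_sets :: "nat \<Rightarrow> (int \<times> bool) set set" where
  "connection_sets p = {S. cayley_set (dihedral_group p) S \<and>
     Digraph_Component.connected (with_proj (cayley_graph (dihedral_group p) S))}"

text \<open>The restriction to \<open>X\<close> makes the map extensional, as members of
  \<open>Bij X\<close> have to be.\<close>

abbreviation image_action :: "'a set set \<Rightarrow> ('a \<Rightarrow> 'a) \<Rightarrow> 'a set \<Rightarrow> 'a set" where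
  "image_action X \<equiv> \<lambda>f. \<lambda>S\<in>X. f ` S"

context
  fixes p :: nat
  assumes p: "prime p" "odd p"
begin

lemma p_gt_2: "p > 2"
  using prime_gt_1_nat[OF p(1)] p(2) by presburger

lemma connection_sets_iff:
  "S \<in> connection_sets p \<longleftrightarrow>
    cayley_set (dihedral_group p) S \<and> (\<exists>b. (b, True) \<in> S) \<and> (\<forall>b. S \<noteq> {(b, True)})"
  using dihedral_cayley_connected_iff[OF p] by (auto simp: connection_sets_def)

text \<open>Affine maps keep the type of an element and are injective, so both obstructions to
  connectedness in \<open>connection_sets_iff\<close> are carried along; paths need not be
  transported.\<close>

lemma connection_sets_image:
  assumes f: "f \<in> auto (dihedral_group p)" and S: "S \<in> connection_sets p"
  shows "f ` S \<in> connection_sets p"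
proof -
  interpret D: group "dihedral_group p" using group_dihedral_group p_gt_2 by simp
  have cS: "cayley_set (dihedral_group p) S" using S by (simp add: connection_sets_iff)
  obtain b where b: "(b, True) \<in> S" using S by (auto simp: connection_sets_iff)
  have sub: "S \<subseteq> carrier (dihedral_group p)" using cS by (simp add: cayley_set_def)
  have fB: "f \<in> Bij (carrier (dihedral_group p))" using f by (simp add: auto_def)
  obtain u v where uv: "f = dihedral_affine p u v"
    using f auto_dihedral_group[OF p_gt_2] by auto
  have snd: "snd (f x) = snd x" if "x \<in> S" for x
    using that sub dihedral_affine_apply[of "fst x" "snd x" p u v] uv by auto
  have "f (b, True) = (fst (f (b, True)), True)"
    using snd[OF b] by (simp add: prod_eq_iff)
  then have "(fst (f (b, True)), True) \<in> f ` S" using imageI[OF b, of f] by simp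
  moreover have "f ` S \<noteq> {(c, True)}" for c
  proof
    assume c: "f ` S = {(c, True)}"
    have "x = (b, True)" if x: "x \<in> S" for x
    proof -
      have "f x \<in> {(c, True)}" "f (b, True) \<in> {(c, True)}"
        unfolding c[symmetric] by (rule imageI[OF x], rule imageI[OF b])
      then have "f x = f (b, True)" by simp
      then show ?thesis using Bij_apply_eq_iff[OF fB subsetD[OF sub x] subsetD[OF sub b]] by simp
    qed
    then have "S = {(b, True)}" using b by blast
    then show False using S by (auto simp: connection_sets_iff)
  qed
  ultimately show ?thesis
    using D.cayley_set_image_auto[OF f cS] by (auto simp: connection_sets_iff)
qed

lemma group_action_connection_sets:
  "group_action (AutoGroup (dihedral_group p)) (connection_sets p) (image_action (connection_sets p))"
proof -
  interpret D: group "dihedral_group p" using group_dihedral_group p_gt_2 by simp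
  show ?thesis unfolding AutoGroup_def
  proof (rule group_action_on_subsets[OF D.subgroup_auto])
    show "connection_sets p \<subseteq> Pow (carrier (dihedral_group p))"
      by (auto simp: connection_sets_def cayley_set_def)
  qed (rule connection_sets_image)
qed

text \<open>Left to right is the CI property proved above. Conversely, a group automorphism commutes
  with \<open>y \<otimes> inv x\<close> and is itself a graph isomorphism.\<close>

lemma cayley_graph_iso_iff:
  assumes S: "S \<in> connection_sets p" and T: "T \<in> connection_sets p"
  shows "digraph_iso (with_proj (cayley_graph (dihedral_group p) S))
      (with_proj (cayley_graph (dihedral_group p) T)) \<longleftrightarrow>
    (\<exists>f\<in>auto (dihedral_group p). T = f ` S)" (is "?L \<longleftrightarrow> ?R")
proof -
  let ?D = "dihedral_group p"
  interpret D: group ?D using group_dihedral_group p_gt_2 by simp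
  have fin: "finite (carrier ?D)" by (simp add: carrier_dihedral_group)
  have wf: "pair_wf_digraph (cayley_graph ?D S)" if "S \<in> connection_sets p" for S
  proof -
    interpret pair_graph "cayley_graph ?D S"
      by (rule pair_graph_cayley_graph[OF D.is_group fin]) (use that in \<open>simp add: connection_sets_def\<close>)
    show ?thesis by unfold_locales
  qed
  have sub: "S \<subseteq> carrier ?D" "T \<subseteq> carrier ?D"
    using S T by (auto simp: connection_sets_def cayley_set_def)
  have iso: "?L \<longleftrightarrow> (\<exists>f. bij_betw f (carrier ?D) (carrier ?D) \<and>
      (\<forall>x\<in>carrier ?D. \<forall>y\<in>carrier ?D.
        y \<otimes>\<^bsub>?D\<^esub> inv\<^bsub>?D\<^esub> x \<in> S \<longleftrightarrow> f y \<otimes>\<^bsub>?D\<^esub> inv\<^bsub>?D\<^esub> (f x) \<in> T))"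
    unfolding digraph_iso_with_proj_iff[OF wf[OF S] wf[OF T]]
    by (intro ex_cong1 conj_cong refl ball_cong)
       (auto simp: cayley_graph_def dest: bij_betwE)
  show ?thesis
  proof
    assume ?L
    then obtain f where "bij_betw f (carrier ?D) (carrier ?D)"
      "\<And>x y. x \<in> carrier ?D \<Longrightarrow> y \<in> carrier ?D \<Longrightarrow>
        y \<otimes>\<^bsub>?D\<^esub> inv\<^bsub>?D\<^esub> x \<in> S \<longleftrightarrow> f y \<otimes>\<^bsub>?D\<^esub> inv\<^bsub>?D\<^esub> (f x) \<in> T"
      unfolding iso by blast
    from dihedral_cayley_isomorphism[OF p sub this]
    show ?R using auto_dihedral_group[OF p_gt_2] by blast
  next
    assume ?R
    then obtain f where f: "f \<in> auto ?D" "T = f ` S" by blast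
    have fB: "f \<in> Bij (carrier ?D)" using f by (simp add: auto_def)
    show ?L unfolding iso
    proof (intro exI[of _ f] conjI ballI)
      show "bij_betw f (carrier ?D) (carrier ?D)" using fB by (simp add: Bij_def)
      fix x y assume xy: "x \<in> carrier ?D" "y \<in> carrier ?D"
      let ?q = "y \<otimes>\<^bsub>?D\<^esub> inv\<^bsub>?D\<^esub> x"
      have "?q \<in> S \<longleftrightarrow> f ?q \<in> f ` S"
      proof
        assume "f ?q \<in> f ` S"
        then obtain z where z: "z \<in> S" "f ?q = f z" by blast
        then have "?q = z" using Bij_apply_eq_iff[OF fB, of ?q z] xy sub(1) by auto
        with z show "?q \<in> S" by simp
      qed simp
      then show "?q \<in> S \<longleftrightarrow> f y \<otimes>\<^bsub>?D\<^esub> inv\<^bsub>?D\<^esub> (f x) \<in> T"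
        using D.auto_preserves_quotient[OF f(1) xy] f(2) by simp
    qed
  qed
qed

text \<open>A connection set is recovered from its graph as the neighbourhood of the identity. Sets
  and graphs thus correspond one to one, and isomorphism classes are images of orbits.\<close>

lemma num_connected_cayley_graphs_eq_card_orbits:
  "num_up_to_iso (connected_cayley_graphs (dihedral_group p)) =
    card (orbits (AutoGroup (dihedral_group p)) (connection_sets p) (image_action (connection_sets p)))"
proof -
  let ?D = "dihedral_group p" and ?X = "connection_sets p"
  let ?g = "\<lambda>S. with_proj (cayley_graph ?D S)" and ?a = "image_action ?X"
  interpret D: group ?D using group_dihedral_group p_gt_2 by simp
  have G: "connected_cayley_graphs ?D = ?g ` ?X"
    by (auto simp: connected_cayley_graphs_def connection_sets_def)
  have inj: "inj_on ?g ?X"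
  proof (rule inj_onI)
    fix S T assume ST: "S \<in> ?X" "T \<in> ?X" "?g S = ?g T"
    have arcs: "parcs (cayley_graph ?D S) = parcs (cayley_graph ?D T)"
      using arg_cong[OF ST(3), of arcs] by simp
    have mem: "x \<in> R \<longleftrightarrow> (\<one>\<^bsub>?D\<^esub>, x) \<in> parcs (cayley_graph ?D R)" if "R \<in> ?X" for x R
      using that by (auto simp: cayley_graph_def connection_sets_def cayley_set_def)
    show "S = T" using mem[OF ST(1)] mem[OF ST(2)] arcs by auto
  qed
  have orb: "orbit (AutoGroup ?D) ?a S = {T \<in> ?X. \<exists>f\<in>auto ?D. T = f ` S}" if "S \<in> ?X" for S
    using that connection_sets_image by (auto simp: orbit_def AutoGroup_def)
  have cls: "digraph_iso_on (?g ` ?X) `` {?g S} = ?g ` orbit (AutoGroup ?D) ?a S" if S: "S \<in> ?X" for S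
  proof -
    have "digraph_iso_on (?g ` ?X) `` {?g S} = ?g ` {T \<in> ?X. digraph_iso (?g S) (?g T)}"
      using S by (auto simp: digraph_iso_on_def)
    also have "{T \<in> ?X. digraph_iso (?g S) (?g T)} = orbit (AutoGroup ?D) ?a S"
      unfolding orb[OF S] using cayley_graph_iso_iff[OF S] by blast
    finally show ?thesis .
  qed
  have "(?g ` ?X) // digraph_iso_on (?g ` ?X) = (\<lambda>S. ?g ` orbit (AutoGroup ?D) ?a S) ` ?X"
    using cls by (auto simp: quotient_def)
  also have "\<dots> = image ?g ` orbits (AutoGroup ?D) ?X ?a"
    by (auto simp: orbits_def)
  finally have "num_up_to_iso (connected_cayley_graphs ?D) = card (image ?g ` orbits (AutoGroup ?D) ?X ?a)"
    by (simp add: num_up_to_iso_def G)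
  also have "\<dots> = card (orbits (AutoGroup ?D) ?X ?a)"
  proof (rule card_image)
    have "orbits (AutoGroup ?D) ?X ?a \<subseteq> Pow ?X" using orb by (auto simp: orbits_def)
    then show "inj_on (image ?g) (orbits (AutoGroup ?D) ?X ?a)"
      using inj_on_image_Pow[OF inj] inj_on_subset by blast
  qed
  finally show ?thesis .
qed

end

section \<open>Counting invariant connection sets\<close>

text \<open>Subsets of the integers modulo \<open>d\<close>, encoded as sets of naturals so that
  exponents never have to be reduced. Every set is \<open>periodic 0\<close>, in keeping with
  \<open>gcd 0 b = b\<close>.\<close>

definition periodic :: "nat \<Rightarrow> nat set \<Rightarrow> bool" where
  "periodic d Q \<longleftrightarrow> (\<forall>k. k + d \<in> Q \<longleftrightarrow> k \<in> Q)"

lemma periodic_mult: "periodic d Q \<Longrightarrow> k + d * j \<in> Q \<longleftrightarrow> k \<in> Q"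
proof (induction j)
  case (Suc j)
  have "k + d * Suc j = (k + d * j) + d" by simp
  then show ?case using Suc unfolding periodic_def by metis
qed simp

lemma periodic_dvd: "periodic d Q \<Longrightarrow> d dvd a \<Longrightarrow> periodic a Q"
  using periodic_mult by (auto simp: periodic_def)

lemma periodic_mod: "periodic d Q \<Longrightarrow> k mod d \<in> Q \<longleftrightarrow> k \<in> Q"
  using periodic_mult[of d Q "k mod d" "k div d"] by simp

text \<open>Merges two invariances into one period: the shift by \<open>i\<close> from
  multiplication by \<open>g ^ i\<close>, and the shift by \<open>m\<close> or
  \<open>p - 1\<close>.\<close>

lemma periodic_gcd_iff: "periodic (gcd a b) Q \<longleftrightarrow> periodic a Q \<and> periodic b Q"
proof
  assume ab: "periodic a Q \<and> periodic b Q"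
  show "periodic (gcd a b) Q"
  proof (cases "a = 0")
    case False
    then obtain s t where st: "a * s = b * t + gcd a b" using bezout_nat by blast
    have "k + gcd a b \<in> Q \<longleftrightarrow> k \<in> Q" for k
    proof -
      have "k + gcd a b \<in> Q \<longleftrightarrow> (k + gcd a b) + b * t \<in> Q" using periodic_mult ab by blast
      also have "(k + gcd a b) + b * t = k + a * s" using st by simp
      also have "\<dots> \<in> Q \<longleftrightarrow> k \<in> Q" using periodic_mult ab by blast
      finally show ?thesis .
    qed
    then show ?thesis by (simp add: periodic_def)
  qed (use ab in simp)
qed (auto intro: periodic_dvd)

lemma card_periodic:
  assumes "d > 0"
  shows "card {Q. periodic d Q} = 2 ^ d"
proof -
  have "bij_betw (\<lambda>Q. Q \<inter> {..<d}) {Q. periodic d Q} (Pow {..<d})"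
  proof (rule bij_betwI[where g = "\<lambda>R. {k. k mod d \<in> R}"])
    show "(\<lambda>R. {k. k mod d \<in> R}) \<in> Pow {..<d} \<rightarrow> {Q. periodic d Q}"
      by (auto simp: periodic_def)
    show "{k. k mod d \<in> Q \<inter> {..<d}} = Q" if "Q \<in> {Q. periodic d Q}" for Q
      using that assms periodic_mod by auto
    show "{k. k mod d \<in> R} \<inter> {..<d} = R" if "R \<in> Pow {..<d}" for R
      using that by auto
  qed auto
  from bij_betw_same_card[OF this] show ?thesis by (simp add: card_Pow)
qed

section \<open>Discrete logarithms and invariant sets of residues\<close>

locale odd_prime_root =
  fixes p g :: nat
  assumes p: "prime p" "odd p" and g: "residue_primroot p g"
begin

definition m :: nat where "m = (p - 1) div 2"

definition pw :: "nat \<Rightarrow> int" where "pw k = int g ^ k mod int p"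

lemma p_gt: "p > 2" by (rule p_gt_2[OF p])

lemma two_m: "p - 1 = 2 * m" using p(2) by (simp add: m_def)

lemma m_pos: "m > 0" using two_m p_gt by simp

lemma p_coprime_iff: "coprime (u::int) (int p) \<longleftrightarrow> \<not> int p dvd u"
  using p(1) p_gt
  by (metis coprime_commute coprime_absorb_left prime_imp_coprime prime_nat_int_transfer not_prime_unit)

lemma ord_g: "ord p g = p - 1" and coprime_g: "coprime p g"
  using g totient_prime[OF p(1)] by (auto simp: residue_primroot_def)

lemma pw_eq_iff: "pw k = pw j \<longleftrightarrow> k mod (p - 1) = j mod (p - 1)"
proof -
  have "pw k = pw j \<longleftrightarrow> [g ^ k = g ^ j] (mod p)"
    unfolding pw_def cong_def by (metis of_nat_eq_iff of_nat_mod of_nat_power)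
  also have "\<dots> \<longleftrightarrow> [k = j] (mod ord p g)"
    by (rule order_divides_expdiff) (rule coprime_g)
  finally show ?thesis by (simp add: ord_g cong_def)
qed

lemma pw_range: "pw k \<in> {1..<int p}"
proof -
  have "\<not> int p dvd int g ^ k"
    using coprime_g p(1) p_coprime_iff by (metis coprime_commute coprime_int_iff coprime_power_left_iff)
  then have "pw k \<noteq> 0" by (simp add: pw_def dvd_eq_mod_eq_0)
  moreover have "0 \<le> pw k" "pw k < int p" using p_gt by (simp_all add: pw_def)
  ultimately show ?thesis by simp
qed

lemma pw_surj:
  assumes "x \<in> {1..<int p}"
  obtains k where "k < p - 1" "pw k = x"
proof -
  have "nat x \<in> totatives p" using assms p(1) by (auto simp: totatives_prime)
  also have "totatives p = (\<lambda>i. g ^ i mod p) ` {..<totient p}"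
    using residue_primroot_is_generator[OF _ g] p_gt by (simp add: bij_betw_def)
  finally obtain k where k: "k < p - 1" "nat x = g ^ k mod p"
    using totient_prime[OF p(1)] by auto
  have "pw k = int (nat x)" by (simp only: k(2) pw_def of_nat_mod of_nat_power)
  also have "\<dots> = x" using assms by simp
  finally show thesis using that k by blast
qed

text \<open>The logarithm is determined only modulo \<open>p - 1\<close>; this suffices, as it is
  only tested for membership in sets of period \<open>p - 1\<close>.\<close>

definition ind :: "int \<Rightarrow> nat" where "ind x = (SOME k. pw k = x)"

lemma pw_ind: "x \<in> {1..<int p} \<Longrightarrow> pw (ind x) = x"
  unfolding ind_def by (rule someI_ex) (metis pw_surj)

lemma ind_pw: "ind (pw k) mod (p - 1) = k mod (p - 1)"
  using pw_ind[OF pw_range] pw_eq_iff by blast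

lemma pw_mult: "(int g ^ i * pw k) mod int p = pw (k + i)"
  by (simp add: pw_def power_add mod_simps mult.commute)

text \<open>\<open>g ^ m\<close> squares to 1 but is not 1, since \<open>g\<close> has order
  \<open>2 * m\<close>; modulo a prime it must be -1. Negation is thus a shift of exponents by
  \<open>m\<close>.\<close>

lemma pw_uminus: "(- pw k) mod int p = pw (k + m)"
proof -
  have "[int g ^ m * int g ^ m = 1] (mod int p)"
  proof -
    have "pw (2 * m) = pw 0" unfolding pw_eq_iff two_m by simp
    then show ?thesis using p_gt by (simp add: pw_def cong_def mult_2 power_add)
  qed
  then have "int p dvd (int g ^ m - 1) * (int g ^ m + 1)"
    by (simp add: cong_iff_dvd_diff algebra_simps)
  moreover have "\<not> int p dvd int g ^ m - 1"
  proof
    assume "int p dvd int g ^ m - 1"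
    then have "pw m = pw 0" by (simp add: pw_def mod_eq_dvd_iff)
    then show False unfolding pw_eq_iff two_m using m_pos by simp
  qed
  ultimately have "int p dvd int g ^ m + 1"
    using p(1) by (meson prime_dvd_mult_iff prime_nat_int_transfer)
  then have "int p dvd (int g ^ m + 1) * int g ^ k" by (rule dvd_mult2)
  then have "int p dvd - (int g ^ k) - int g ^ (k + m)"
    by (subst dvd_minus_iff[symmetric]) (simp add: power_add algebra_simps)
  then have "(- (int g ^ k)) mod int p = int g ^ (k + m) mod int p" by (simp add: mod_eq_dvd_iff)
  then show ?thesis by (simp add: pw_def mod_simps)
qed


text \<open>\<open>rot_sets u\<close> and \<open>refl_sets u v\<close> hold the possible halves
  \<open>A\<close> and \<open>B\<close> of a set fixed by \<open>dihedral_affine p u v\<close>,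
  before connectedness is imposed.\<close>

definition rot_sets :: "int \<Rightarrow> int set set" where
  "rot_sets u = {A. A \<subseteq> {1..<int p} \<and> (\<forall>a\<in>A. (- a) mod int p \<in> A) \<and>
     (\<forall>a\<in>{0..<int p}. a \<in> A \<longleftrightarrow> (u * a) mod int p \<in> A)}"

definition refl_sets :: "int \<Rightarrow> int \<Rightarrow> int set set" where
  "refl_sets u v = {B. B \<subseteq> {0..<int p} \<and>
     (\<forall>b\<in>{0..<int p}. b \<in> B \<longleftrightarrow> (u * b + v) mod int p \<in> B)}"

lemma m_dvd: "m dvd p - 1"
  unfolding two_m by simp

lemma rot_setsD:
  assumes "A \<in> rot_sets u"
  shows "A \<subseteq> {1..<int p}" "a \<in> A \<Longrightarrow> (- a) mod int p \<in> A"
    "a \<in> {0..<int p} \<Longrightarrow> (u * a) mod int p \<in> A \<longleftrightarrow> a \<in> A"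
  using assms unfolding rot_sets_def by blast+

lemma refl_setsD:
  assumes "B \<in> refl_sets u v"
  shows "B \<subseteq> {0..<int p}" "b \<in> {0..<int p} \<Longrightarrow> (u * b + v) mod int p \<in> B \<longleftrightarrow> b \<in> B"
  using assms unfolding refl_sets_def by blast+

text \<open>In logarithms, invariance under \<open>g ^ i\<close> is period \<open>i\<close> and
  closure under negation is period \<open>m\<close>; the latter already implies period
  \<open>p - 1 = 2 * m\<close>.\<close>

lemma card_rot_sets: "card (rot_sets (int g ^ i)) = 2 ^ gcd i m"
proof -
  have "bij_betw (\<lambda>A. {k. pw k \<in> A}) (rot_sets (int g ^ i)) {Q. periodic (gcd i m) Q}"
  proof (rule bij_betwI[where g = "\<lambda>Q. {a \<in> {1..<int p}. ind a \<in> Q}"])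
    show "(\<lambda>A. {k. pw k \<in> A}) \<in> rot_sets (int g ^ i) \<rightarrow> {Q. periodic (gcd i m) Q}"
    proof
      fix A assume A: "A \<in> rot_sets (int g ^ i)"
      have "pw (k + i) \<in> A \<longleftrightarrow> pw k \<in> A" for k
      proof -
        have "pw k \<in> {0..<int p}" using pw_range[of k] by simp
        from rot_setsD(3)[OF A this] show ?thesis by (simp add: pw_mult)
      qed
      moreover have neg: "pw (k + m) \<in> A" if "pw k \<in> A" for k
        using rot_setsD(2)[OF A that] by (simp add: pw_uminus)
      \<comment> \<open>Closure under negation is one implication; negating twice, a shift by
        \<open>2 * m = p - 1\<close>, yields the other.\<close>
      have "pw (k + m) \<in> A \<longleftrightarrow> pw k \<in> A" for k
      proof
        assume "pw (k + m) \<in> A"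
        then have "pw (k + m + m) \<in> A" by (rule neg)
        moreover have "pw (k + m + m) = pw k" unfolding pw_eq_iff two_m by (simp add: add.assoc flip: mult_2)
        ultimately show "pw k \<in> A" by simp
      qed (rule neg)
      ultimately show "{k. pw k \<in> A} \<in> {Q. periodic (gcd i m) Q}"
        unfolding mem_Collect_eq periodic_gcd_iff by (simp add: periodic_def)
    qed
    show "(\<lambda>Q. {a \<in> {1..<int p}. ind a \<in> Q}) \<in> {Q. periodic (gcd i m) Q} \<rightarrow> rot_sets (int g ^ i)"
    proof
      fix Q assume "Q \<in> {Q. periodic (gcd i m) Q}"
      then have Q: "periodic i Q" "periodic m Q" by (simp_all add: periodic_gcd_iff)
      have Qp: "periodic (p - 1) Q" by (rule periodic_dvd[OF Q(2) m_dvd])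
      have ind: "ind (pw k) \<in> Q \<longleftrightarrow> k \<in> Q" for k
        using periodic_mod[OF Qp] ind_pw[of k] by metis
      let ?A = "{a \<in> {1..<int p}. ind a \<in> Q}"
      have mem: "pw k \<in> ?A \<longleftrightarrow> k \<in> Q" for k using pw_range ind by simp
      have z: "0 \<notin> ?A" by simp
      have "(- a) mod int p \<in> ?A" if a: "a \<in> ?A" for a
      proof -
        have "pw (ind a) = a" using a by (intro pw_ind) simp
        then obtain k where k: "pw k = a" by blast
        then show ?thesis using a mem[of k] mem[of "k + m"] pw_uminus[of k] Q(2)
          by (simp add: periodic_def)
      qed
      moreover have "a \<in> ?A \<longleftrightarrow> (int g ^ i * a) mod int p \<in> ?A" if a: "a \<in> {0..<int p}" for a
      proof (cases "a = 0")
        case False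
        with a have "a \<in> {1..<int p}" by simp
        then obtain k where k: "pw k = a" using pw_ind by blast
        show ?thesis
          unfolding k[symmetric] pw_mult mem using Q(1) by (simp add: periodic_def)
      qed simp
      ultimately show "?A \<in> rot_sets (int g ^ i)"
        unfolding rot_sets_def by blast
    qed
    show "{a \<in> {1..<int p}. ind a \<in> {k. pw k \<in> A}} = A" if "A \<in> rot_sets (int g ^ i)" for A
      using rot_setsD(1)[OF that] pw_ind by auto
    show "{k. pw k \<in> {a \<in> {1..<int p}. ind a \<in> Q}} = Q" if "Q \<in> {Q. periodic (gcd i m) Q}" for Q
    proof -
      have "periodic (p - 1) Q"
        using that by (intro periodic_dvd[OF _ dvd_trans[OF gcd_dvd2[of i] m_dvd]]) simp
      then have "ind (pw k) \<in> Q \<longleftrightarrow> k \<in> Q" for k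
        using periodic_mod ind_pw[of k] by metis
      then show ?thesis using pw_range by auto
    qed
  qed
  from bij_betw_same_card[OF this] show ?thesis
    using card_periodic m_pos by simp
qed

text \<open>Around the fixed residue \<open>y\<close> the affine map is linear:
  \<open>sh k = y + g ^ k\<close> goes to \<open>sh (k + i)\<close>. Membership of \<open>y\<close>
  is free, which is the factor 2, and the rest is a set of exponents with periods \<open>i\<close>
  and \<open>p - 1\<close>. The period is not \<open>m\<close>, since reflections obey no negation
  condition.\<close>

lemma card_refl_sets:
  assumes y: "y \<in> {0..<int p}" "(int g ^ i * y + v) mod int p = y"
  shows "card (refl_sets (int g ^ i) v) = 2 * 2 ^ gcd i (p - 1)"
proof -
  let ?u = "int g ^ i"
  have p0: "int p > 0" using p_gt by simp
  define sh where "sh = (\<lambda>k. (y + pw k) mod int p)"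
  define un where "un = (\<lambda>b. ind ((b - y) mod int p))"
  have sh_range: "sh k \<in> {0..<int p}" for k using p0 by (simp add: sh_def)
  have sh_diff: "(sh k - y) mod int p = pw k" for k
    using pw_range[of k] by (simp add: sh_def mod_simps)
  have sh_ne: "sh k \<noteq> y" for k using sh_diff[of k] pw_range[of k] by auto
  have un_range: "(b - y) mod int p \<in> {1..<int p}" if "b \<in> {0..<int p}" "b \<noteq> y" for b
  proof -
    have "(b - y) mod int p \<noteq> 0"
    proof
      assume "(b - y) mod int p = 0"
      then have "b mod int p = y mod int p" by (simp add: mod_eq_dvd_iff dvd_eq_mod_eq_0)
      then show False using that y by simp
    qed
    moreover have "0 \<le> (b - y) mod int p" "(b - y) mod int p < int p" using p0 by simp_all
    ultimately show ?thesis by simp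
  qed
  have sh_un: "sh (un b) = b" if b: "b \<in> {0..<int p}" "b \<noteq> y" for b
    using pw_ind[OF un_range[OF b]] b(1) by (simp add: sh_def un_def mod_simps)
  have sh_mult: "(?u * sh k + v) mod int p = sh (k + i)" for k
  proof -
    have "(?u * sh k + v) mod int p = (?u * (y + pw k) + v) mod int p"
      unfolding sh_def by (rule mod_affine_mod)
    also have "?u * (y + pw k) + v = (?u * y + v) + ?u * pw k" by (simp add: algebra_simps)
    also have "\<dots> mod int p = ((?u * y + v) mod int p + (?u * pw k) mod int p) mod int p"
      by (simp add: mod_simps)
    finally show ?thesis by (simp add: y(2) pw_mult sh_def)
  qed
  have "bij_betw (\<lambda>B. (y \<in> B, {k. sh k \<in> B})) (refl_sets ?u v)
    (UNIV \<times> {Q. periodic (gcd i (p - 1)) Q})"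
  proof (rule bij_betwI[where g = "\<lambda>(e, Q). {b \<in> {0..<int p}. if b = y then e else un b \<in> Q}"])
    show "(\<lambda>B. (y \<in> B, {k. sh k \<in> B})) \<in> refl_sets ?u v \<rightarrow> UNIV \<times> {Q. periodic (gcd i (p - 1)) Q}"
    proof
      fix B assume B: "B \<in> refl_sets ?u v"
      have "sh (k + i) \<in> B \<longleftrightarrow> sh k \<in> B" for k
        using refl_setsD(2)[OF B sh_range[of k]] by (simp add: sh_mult)
      moreover have "sh (k + (p - 1)) = sh k" for k
        using pw_eq_iff[of "k + (p - 1)" k] by (simp add: sh_def)
      ultimately have "periodic (gcd i (p - 1)) {k. sh k \<in> B}"
        unfolding periodic_gcd_iff by (simp add: periodic_def)
      then show "(y \<in> B, {k. sh k \<in> B}) \<in> UNIV \<times> {Q. periodic (gcd i (p - 1)) Q}" by simp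
    qed
    have un_sh: "un (sh k) \<in> Q \<longleftrightarrow> k \<in> Q" if "periodic (p - 1) Q" for k Q
      unfolding un_def sh_diff using periodic_mod[OF that] ind_pw[of k] by metis
    show "(\<lambda>(e, Q). {b \<in> {0..<int p}. if b = y then e else un b \<in> Q})
        \<in> UNIV \<times> {Q. periodic (gcd i (p - 1)) Q} \<rightarrow> refl_sets ?u v"
    proof (rule funcsetI, clarify)
      fix e Q assume "periodic (gcd i (p - 1)) Q"
      then have Q: "periodic i Q" "periodic (p - 1) Q" by (simp_all add: periodic_gcd_iff)
      let ?B = "{b \<in> {0..<int p}. if b = y then e else un b \<in> Q}"
      have mem: "sh k \<in> ?B \<longleftrightarrow> k \<in> Q" for k using sh_range[of k] sh_ne[of k] un_sh[OF Q(2)] by simp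
      have "b \<in> ?B \<longleftrightarrow> (?u * b + v) mod int p \<in> ?B" if b: "b \<in> {0..<int p}" for b
      proof (cases "b = y")
        case False
        then obtain k where k: "b = sh k" using sh_un[OF b] by metis
        show ?thesis unfolding k sh_mult mem using Q(1) by (simp add: periodic_def)
      qed (use y in simp)
      then show "?B \<in> refl_sets ?u v" unfolding refl_sets_def by blast
    qed
    show "(case (y \<in> B, {k. sh k \<in> B}) of
        (e, Q) \<Rightarrow> {b \<in> {0..<int p}. if b = y then e else un b \<in> Q}) = B"
      if B: "B \<in> refl_sets ?u v" for B
    proof -
      have "(if b = y then y \<in> B else un b \<in> {k. sh k \<in> B}) \<longleftrightarrow> b \<in> B" if "b \<in> {0..<int p}" for b
        using sh_un[OF that] by simp
      then have "{b \<in> {0..<int p}. if b = y then y \<in> B else un b \<in> {k. sh k \<in> B}}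
          = {b \<in> {0..<int p}. b \<in> B}" by blast
      then show ?thesis using refl_setsD(1)[OF B] by auto
    qed
    show "(y \<in> (case eQ of (e, Q) \<Rightarrow> {b \<in> {0..<int p}. if b = y then e else un b \<in> Q}),
        {k. sh k \<in> (case eQ of (e, Q) \<Rightarrow> {b \<in> {0..<int p}. if b = y then e else un b \<in> Q})}) = eQ"
      if "eQ \<in> UNIV \<times> {Q. periodic (gcd i (p - 1)) Q}" for eQ
    proof (cases eQ)
      case (Pair e Q)
      have "periodic (p - 1) Q" using that Pair by (simp add: periodic_gcd_iff)
      then show ?thesis using Pair y(1) sh_range sh_ne un_sh by simp
    qed
  qed
  from bij_betw_same_card[OF this] have "card (refl_sets ?u v) = 2 * card {Q. periodic (gcd i (p - 1)) Q}"
    by (simp add: card_cartesian_product)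
  then show ?thesis using card_periodic[of "gcd i (p - 1)"] p_gt by simp
qed

lemma card_refl_sets_id: "card (refl_sets 1 0) = 2 ^ p"
proof -
  have "refl_sets 1 0 = Pow {0..<int p}" by (auto simp: refl_sets_def)
  then show ?thesis by (simp add: card_Pow)
qed

text \<open>A nonzero translation is transitive on the residues modulo a prime, so an invariant set
  is empty or full.\<close>

lemma card_refl_sets_translation:
  assumes v: "\<not> int p dvd v"
  shows "card (refl_sets 1 v) = 2"
proof -
  have p0: "int p > 0" using p_gt by simp
  have "refl_sets 1 v = {{}, {0..<int p}}"
  proof (intro equalityI subsetI)
    fix B assume B: "B \<in> refl_sets 1 v"
    show "B \<in> {{}, {0..<int p}}"
    proof (cases "B = {}")
      case False
      then obtain b where b: "b \<in> B" by blast
      have sub: "B \<subseteq> {0..<int p}" by (rule refl_setsD(1)[OF B])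
      have steps: "(b + int n * v) mod int p \<in> B" for n
      proof (induction n)
        case 0
        then show ?case using b sub by auto
      next
        case (Suc n)
        have "(1 * ((b + int n * v) mod int p) + v) mod int p \<in> B"
          using refl_setsD(2)[OF B subsetD[OF sub Suc]] Suc by blast
        then show ?case by (simp add: mod_simps algebra_simps)
      qed
      obtain l where l: "[v * l = 1] (mod int p)"
        using cong_solve_coprime_int v p_coprime_iff by blast
      have "x \<in> B" if x: "x \<in> {0..<int p}" for x
      proof -
        define n where "n = nat (((x - b) * l) mod int p)"
        have n: "int n = ((x - b) * l) mod int p" using p0 by (simp add: n_def)
        have "(b + int n * v) mod int p = (v * (((x - b) * l) mod int p) + b) mod int p"
          by (simp add: n algebra_simps)
        also have "\<dots> = (v * ((x - b) * l) + b) mod int p" by (rule mod_affine_mod)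
        also have "\<dots> = ((x - b) * (v * l) + b) mod int p" by (simp add: ac_simps)
        also have "\<dots> = ((x - b) * 1 + b) mod int p"
          using cong_add[OF cong_scalar_left[OF l, of "x - b"] cong_refl[of b]] by (simp add: cong_def)
        also have "\<dots> = x" using x by simp
        finally show ?thesis using steps[of n] by simp
      qed
      then show ?thesis using sub by blast
    qed simp
  next
    fix B assume "B \<in> {{}, {0..<int p}}"
    then show "B \<in> refl_sets 1 v" using p0 by (auto simp: refl_sets_def)
  qed
  moreover have "{} \<noteq> {0..<int p}" using p0 by auto
  ultimately show ?thesis by simp
qed


abbreviation fixed_residues :: "int \<Rightarrow> int \<Rightarrow> int set" where
  "fixed_residues u v \<equiv> {b \<in> {0..<int p}. (u * b + v) mod int p = b}"

lemma finite_rot_sets: "finite (rot_sets u)"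
  by (rule finite_subset[of _ "Pow {1..<int p}"]) (use rot_setsD(1) in auto)

lemma finite_refl_sets: "finite (refl_sets u v)"
  by (rule finite_subset[of _ "Pow {0..<int p}"]) (use refl_setsD(1) in auto)

text \<open>Identifies the disconnected pairs \<open>({}, {b})\<close> among the invariant ones:
  there is one for each fixed residue.\<close>

lemma singleton_in_refl_sets_iff:
  assumes u: "coprime u (int p)"
  shows "{b} \<in> refl_sets u v \<longleftrightarrow> b \<in> fixed_residues u v"
proof
  assume B: "{b} \<in> refl_sets u v"
  then have "b \<in> {0..<int p}" using refl_setsD(1) by blast
  with refl_setsD(2)[OF B this] show "b \<in> fixed_residues u v" by simp
next
  assume b: "b \<in> fixed_residues u v"
  have "c \<in> {b} \<longleftrightarrow> (u * c + v) mod int p \<in> {b}" if c: "c \<in> {0..<int p}" for c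
  proof
    assume "(u * c + v) mod int p \<in> {b}"
    then have "(u * c + v) mod int p = (u * b + v) mod int p" using b by simp
    then have "c mod int p = b mod int p" by (rule mod_mult_left_cancel[OF u])
    then show "c \<in> {b}" using b c by simp
  qed (use b in simp)
  moreover have "{b} \<subseteq> {0..<int p}" using b by simp
  ultimately show "{b} \<in> refl_sets u v" unfolding refl_sets_def by blast
qed

section \<open>Fixed connection sets as pairs of a rotation half and a reflection half\<close>

definition join :: "int set \<times> int set \<Rightarrow> (int \<times> bool) set" where
  "join = (\<lambda>(A, B). A \<times> {False} \<union> B \<times> {True})"

lemma join_iff [simp]:
  "(a, False) \<in> join (A, B) \<longleftrightarrow> a \<in> A" "(a, True) \<in> join (A, B) \<longleftrightarrow> a \<in> B"
  by (auto simp: join_def)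

lemma inj_join: "inj join"
proof (rule injI)
  fix x y assume eq: "join x = join y"
  obtain A B A' B' where xy: "x = (A, B)" "y = (A', B')" by (cases x; cases y)
  have "a \<in> A \<longleftrightarrow> a \<in> A'" "a \<in> B \<longleftrightarrow> a \<in> B'" for a
    using eq join_iff unfolding xy by metis+
  then show "x = y" using xy by blast
qed

lemma join_surj: obtains A B where "S = join (A, B)"
proof
  show "S = join ({a. (a, False) \<in> S}, {b. (b, True) \<in> S})"
  proof (rule Set.set_eqI)
    fix x show "x \<in> S \<longleftrightarrow> x \<in> join ({a. (a, False) \<in> S}, {b. (b, True) \<in> S})"
      by (cases x; cases "snd x") auto
  qed
qed

text \<open>Affine maps keep types, so invariance splits into separate conditions on the halves. The
  two set differences remove the disconnected graphs.\<close>

lemma fixed_connection_sets: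
  assumes u: "coprime u (int p)"
  shows "{S \<in> connection_sets p. dihedral_affine p u v ` S = S} =
    join ` (rot_sets u \<times> (refl_sets u v - {{}}) - {{}} \<times> (\<lambda>b. {b}) ` fixed_residues u v)"
    (is "?L = join ` ?R")
proof -
  have p0: "p > 0" using p_gt by simp
  let ?D = "dihedral_group p" and ?f = "dihedral_affine p u v"
  have V: "(b, t) \<in> carrier ?D \<longleftrightarrow> b \<in> {0..<int p}" for b t by (simp add: carrier_dihedral_group)
  have fB: "?f \<in> Bij (carrier ?D)" by (rule dihedral_affine_Bij[OF p0 u])
  have img: "?f ` S = S \<longleftrightarrow> (\<forall>x\<in>carrier ?D. x \<in> S \<longleftrightarrow> ?f x \<in> S)" if S: "S \<subseteq> carrier ?D" for S
  proof
    assume eq: "?f ` S = S"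
    show "\<forall>x\<in>carrier ?D. x \<in> S \<longleftrightarrow> ?f x \<in> S"
    proof (intro ballI iffI)
      fix x assume x: "x \<in> carrier ?D" "?f x \<in> S"
      then obtain z where z: "z \<in> S" "?f x = ?f z" using eq by (metis imageE)
      then have "x = z" using Bij_apply_eq_iff[OF fB x(1) subsetD[OF S z(1)]] by simp
      then show "x \<in> S" using z by simp
    qed (use eq in blast)
  next
    assume inv: "\<forall>x\<in>carrier ?D. x \<in> S \<longleftrightarrow> ?f x \<in> S"
    have surj: "?f ` carrier ?D = carrier ?D" using fB by (simp add: Bij_def bij_betw_def)
    show "?f ` S = S"
    proof (intro equalityI subsetI)
      fix y assume "y \<in> S"
      then obtain x where "x \<in> carrier ?D" "y = ?f x" using S surj by (metis imageE subsetD)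
      then show "y \<in> ?f ` S" using inv \<open>y \<in> S\<close> by simp
    next
      fix y assume "y \<in> ?f ` S"
      then obtain x where x: "x \<in> S" "y = ?f x" by blast
      then show "y \<in> S" using inv subsetD[OF S x(1)] by simp
    qed
  qed
  have main: "join (A, B) \<in> ?L \<longleftrightarrow> (A, B) \<in> ?R" for A B
  proof -
    let ?S = "join (A, B)"
    have sub: "?S \<subseteq> carrier ?D \<longleftrightarrow> A \<subseteq> {0..<int p} \<and> B \<subseteq> {0..<int p}"
      by (auto simp: join_def V)
    have cay: "cayley_set ?D ?S \<longleftrightarrow>
        A \<subseteq> {1..<int p} \<and> B \<subseteq> {0..<int p} \<and> (\<forall>a\<in>A. (- a) mod int p \<in> A)"
    proof -
      have "{1..<int p} = {0..<int p} - {0}" by auto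
      then have "A \<subseteq> {0..<int p} \<and> 0 \<notin> A \<longleftrightarrow> A \<subseteq> {1..<int p}" by blast
      then show ?thesis unfolding cayley_set_dihedral_iff[OF p0] sub join_iff by blast
    qed
    have inv: "?f ` ?S = ?S \<longleftrightarrow> (\<forall>a\<in>{0..<int p}. a \<in> A \<longleftrightarrow> (u * a) mod int p \<in> A) \<and>
        (\<forall>b\<in>{0..<int p}. b \<in> B \<longleftrightarrow> (u * b + v) mod int p \<in> B)" (is "_ \<longleftrightarrow> ?inv") if "?S \<subseteq> carrier ?D"
    proof -
      have f: "?f (a, s) = ((u * a + (if s then v else 0)) mod int p, s)" if "a \<in> {0..<int p}" for a s
        by (rule dihedral_affine_apply) (use that V in simp)
      have "(\<forall>x\<in>carrier ?D. x \<in> ?S \<longleftrightarrow> ?f x \<in> ?S) \<longleftrightarrow>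
          (\<forall>a\<in>{0..<int p}. \<forall>s. (a, s) \<in> ?S \<longleftrightarrow> ?f (a, s) \<in> ?S)"
        by (auto simp: carrier_dihedral_group)
      also have "\<dots> \<longleftrightarrow> (\<forall>a\<in>{0..<int p}. (a \<in> A \<longleftrightarrow> (u * a) mod int p \<in> A) \<and>
          (a \<in> B \<longleftrightarrow> (u * a + v) mod int p \<in> B))"
        by (rule ball_cong[OF refl]) (simp add: f all_bool_eq conj_commute)
      finally show ?thesis unfolding img[OF that] by blast
    qed
    have single: "(\<forall>b. ?S \<noteq> {(b, True)}) \<longleftrightarrow> \<not> (A = {} \<and> (\<exists>b. B = {b}))"
    proof -
      have "?S = {(b, True)} \<longleftrightarrow> A = {} \<and> B = {b}" for b
      proof
        assume eq: "?S = {(b, True)}"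
        have "a \<notin> A" "a \<in> B \<longleftrightarrow> a = b" for a
          using join_iff[of a A B] unfolding eq by auto
        then show "A = {} \<and> B = {b}" by blast
      qed (simp add: join_def)
      then show ?thesis by blast
    qed
    have "?S \<in> ?L \<longleftrightarrow> A \<in> rot_sets u \<and> B \<in> refl_sets u v \<and> B \<noteq> {} \<and> \<not> (A = {} \<and> (\<exists>b. B = {b}))"
    proof (cases "cayley_set ?D ?S")
      case True
      then have S: "?S \<subseteq> carrier ?D" by (simp add: cayley_set_def)
      have "?S \<in> ?L \<longleftrightarrow> (\<exists>b. b \<in> B) \<and> (\<forall>b. ?S \<noteq> {(b, True)}) \<and> ?f ` ?S = ?S"
        using True by (simp add: connection_sets_iff[OF p])
      also have "\<dots> \<longleftrightarrow> B \<noteq> {} \<and> \<not> (A = {} \<and> (\<exists>b. B = {b})) \<and> A \<in> rot_sets u \<and> B \<in> refl_sets u v"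
      proof -
        have "A \<in> rot_sets u \<longleftrightarrow> (\<forall>a\<in>{0..<int p}. a \<in> A \<longleftrightarrow> (u * a) mod int p \<in> A)"
          using True unfolding cay rot_sets_def by blast
        moreover have "B \<in> refl_sets u v \<longleftrightarrow> (\<forall>b\<in>{0..<int p}. b \<in> B \<longleftrightarrow> (u * b + v) mod int p \<in> B)"
          using True unfolding cay refl_sets_def by blast
        moreover have "(\<exists>b. b \<in> B) \<longleftrightarrow> B \<noteq> {}" by blast
        ultimately show ?thesis unfolding single inv[OF S] by argo
      qed
      finally show ?thesis by blast
    next
      case False
      then have "?S \<notin> ?L" by (simp add: connection_sets_iff[OF p])
      moreover have "\<not> (A \<in> rot_sets u \<and> B \<in> refl_sets u v)"
        using False unfolding cay rot_sets_def refl_sets_def by blast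
      ultimately show ?thesis by blast
    qed
    \<comment> \<open>An invariant singleton \<open>B\<close> is exactly a fixed residue.\<close>
    also have "\<dots> \<longleftrightarrow> (A, B) \<in> ?R"
      using singleton_in_refl_sets_iff[OF u, of _ v] by auto
    finally show ?thesis .
  qed
  show ?thesis
  proof (intro equalityI subsetI)
    fix S assume S: "S \<in> ?L"
    obtain A B where AB: "S = join (A, B)" by (rule join_surj)
    have "(A, B) \<in> ?R" by (rule iffD1[OF main S[unfolded AB]])
    then show "S \<in> join ` ?R" unfolding AB by (rule imageI)
  next
    fix S assume "S \<in> join ` ?R"
    then obtain x where x: "S = join x" "x \<in> ?R" by (rule imageE)
    obtain A B where AB: "x = (A, B)" by (cases x)
    show "S \<in> ?L" unfolding x(1) AB by (rule iffD2[OF main x(2)[unfolded AB]])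
  qed
qed

lemma empty_in_rot_sets: "{} \<in> rot_sets u"
  by (simp add: rot_sets_def)

lemma empty_in_refl_sets: "{} \<in> refl_sets u v"
  by (simp add: refl_sets_def)

text \<open>The \<open>- 1\<close> discards the empty reflection half, which is always invariant.
  Integers are used so that the subtractions are genuine.\<close>

lemma card_fixed_connection_sets:
  assumes u: "coprime u (int p)"
  shows "int (card {S \<in> connection_sets p. dihedral_affine p u v ` S = S}) =
    int (card (rot_sets u)) * (int (card (refl_sets u v)) - 1) - int (card (fixed_residues u v))"
proof -
  let ?P = "rot_sets u \<times> (refl_sets u v - {{}})"
  let ?Q = "{{} :: int set} \<times> (\<lambda>b. {b}) ` fixed_residues u v"
  have sub: "?Q \<subseteq> ?P"
    using singleton_in_refl_sets_iff[OF u, of _ v] empty_in_rot_sets by auto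
  have fin: "finite ?P" using finite_rot_sets finite_refl_sets by simp
  have Q: "card ?Q = card (fixed_residues u v)"
    by (simp add: card_cartesian_product card_image)
  have "card (refl_sets u v) \<ge> 1"
    using empty_in_refl_sets finite_refl_sets by (metis One_nat_def Suc_leI card_gt_0_iff empty_iff)
  then have P: "int (card ?P) = int (card (rot_sets u)) * (int (card (refl_sets u v)) - 1)"
    using empty_in_refl_sets finite_refl_sets
    by (simp add: card_cartesian_product card_Diff_singleton of_nat_diff)
  have "card (join ` (?P - ?Q)) = card (?P - ?Q)"
    by (rule card_image) (rule inj_on_subset[OF inj_join], simp)
  also have "\<dots> = card ?P - card ?Q"
    by (rule card_Diff_subset[OF finite_subset[OF sub fin] sub])
  finally have "int (card (join ` (?P - ?Q))) = int (card ?P) - int (card ?Q)"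
    using card_mono[OF fin sub] by simp
  then show ?thesis unfolding fixed_connection_sets[OF u] P Q .
qed

end

text \<open>Grouping the indices by their gcd with \<open>n\<close>, the value \<open>d\<close>
  occurs \<open>totient (n div d)\<close> times; then \<open>d\<close> and \<open>n div d\<close>
  are exchanged.\<close>

lemma sum_gcd_eq_sum_divisors:
  fixes h :: "nat \<Rightarrow> real"
  assumes n: "n > 0"
  shows "(\<Sum>k<n. h (gcd k n)) = (\<Sum>d | d dvd n. real (totient d) * h (n div d))"
proof -
  \<comment> \<open>The index 0 may be traded for \<open>n\<close>, as both have gcd
    \<open>n\<close> with \<open>n\<close>.\<close>
  have "{..<n} = insert 0 {0<..<n}" "{0<..n} = insert n {0<..<n}" using n by auto
  then have "(\<Sum>k<n. h (gcd k n)) = (\<Sum>k\<in>{0<..n}. h (gcd k n))" by simp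
  also have "\<dots> = (\<Sum>d | d dvd n. \<Sum>k\<in>{k \<in> {0<..n}. gcd k n = d}. h (gcd k n))"
    by (rule sum.group[symmetric]) (use n in \<open>auto intro: finite_divisors_nat\<close>)
  also have "\<dots> = (\<Sum>d | d dvd n. real (totient (n div d)) * h d)"
  proof (rule sum.cong[OF refl])
    fix d assume "d \<in> {d. d dvd n}"
    then have "card {k \<in> {0<..n}. gcd k n = d} = totient (n div d)"
      by (intro card_gcd_eq_totient[OF n]) simp
    moreover have "(\<Sum>k\<in>{k \<in> {0<..n}. gcd k n = d}. h (gcd k n)) = (\<Sum>k\<in>{k \<in> {0<..n}. gcd k n = d}. h d)"
      by (rule sum.cong) auto
    ultimately show "(\<Sum>k\<in>{k \<in> {0<..n}. gcd k n = d}. h (gcd k n)) = real (totient (n div d)) * h d"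
      by (simp only: sum_constant)
  qed
  also have "\<dots> = (\<Sum>d | d dvd n. real (totient d) * h (n div d))"
    by (rule sum.reindex_bij_witness[of _ "\<lambda>d. n div d" "\<lambda>d. n div d"])
       (use n in \<open>auto simp: dvd_div_eq_mult elim!: dvdE\<close>)
  finally show ?thesis .
qed

section \<open>Fixed-point counts for each automorphism and the Burnside sum\<close>

context odd_prime_root
begin

lemma root_pow_minus_1:
  assumes "i \<in> {1..<p - 1}"
  shows "\<not> int p dvd int g ^ i - 1"
proof
  assume "int p dvd int g ^ i - 1"
  then have "pw i = pw 0" by (simp add: pw_def mod_eq_dvd_iff)
  then show False using assms by (simp add: pw_eq_iff)
qed

text \<open>A fixed residue solves \<open>(u - 1) * b = - v\<close> modulo \<open>p\<close>, where
  \<open>u - 1\<close> is invertible.\<close>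

lemma fixed_residues_unique:
  assumes u: "\<not> int p dvd u - 1"
  obtains y where "fixed_residues u v = {y}"
proof -
  have p0: "int p > 0" using p_gt by simp
  obtain l where l: "[(u - 1) * l = 1] (mod int p)"
    using cong_solve_coprime_int u p_coprime_iff by blast
  have fixed: "(u * b + v) mod int p = b \<longleftrightarrow> [(u - 1) * b = - v] (mod int p)" if "b \<in> {0..<int p}" for b
  proof -
    have "(u * b + v) mod int p = b \<longleftrightarrow> (u * b + v) mod int p = b mod int p" using that by simp
    also have "\<dots> \<longleftrightarrow> int p dvd (u * b + v) - b" by (rule mod_eq_dvd_iff)
    also have "(u * b + v) - b = (u - 1) * b - (- v)" by (simp add: algebra_simps)
    finally show ?thesis by (simp add: cong_iff_dvd_diff)
  qed
  define y where "y = (l * (- v)) mod int p"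
  have yr: "y \<in> {0..<int p}" using p0 by (simp add: y_def)
  have "[(u - 1) * y = (u - 1) * (l * (- v))] (mod int p)"
    unfolding y_def cong_def by (rule mod_mult_right_eq)
  also have "(u - 1) * (l * (- v)) = (u - 1) * l * (- v)" by (simp add: algebra_simps)
  also have "[\<dots> = 1 * (- v)] (mod int p)" by (rule cong_scalar_right[OF l])
  finally have y: "[(u - 1) * y = - v] (mod int p)" by simp
  have "b = y" if b: "b \<in> {0..<int p}" "[(u - 1) * b = - v] (mod int p)" for b
  proof -
    have "[(u - 1) * b = (u - 1) * y] (mod int p)" using b(2) y cong_sym cong_trans by blast
    then have "((u - 1) * b + 0) mod int p = ((u - 1) * y + 0) mod int p" by (simp add: cong_def)
    then have "b mod int p = y mod int p"
      by (rule mod_mult_left_cancel[rotated]) (use u p_coprime_iff in blast)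
    then show ?thesis using b(1) yr by simp
  qed
  then have "fixed_residues u v = {y}" using fixed yr y by blast
  then show thesis by (rule that)
qed

lemma coprime_root_pow: "coprime (int g ^ i) (int p)"
  using coprime_g by (simp add: coprime_commute)

text \<open>The last \<open>- 1\<close> is the pair \<open>({}, {y})\<close> at the unique fixed
  residue \<open>y\<close>. The value does not depend on \<open>v\<close>.\<close>

lemma card_fixed_general:
  assumes i: "i \<in> {1..<p - 1}"
  shows "int (card {S \<in> connection_sets p. dihedral_affine p (int g ^ i) v ` S = S}) =
    2 ^ gcd i m * (2 * 2 ^ gcd i (p - 1) - 1) - 1"
proof -
  obtain y where y: "fixed_residues (int g ^ i) v = {y}"
    using fixed_residues_unique[OF root_pow_minus_1[OF i]] by blast
  then have "y \<in> fixed_residues (int g ^ i) v" by simp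
  then have "card (refl_sets (int g ^ i) v) = 2 * 2 ^ gcd i (p - 1)"
    by (intro card_refl_sets[of y]) simp_all
  then show ?thesis
    unfolding card_fixed_connection_sets[OF coprime_root_pow] y card_rot_sets by simp
qed

lemma card_fixed_id:
  "int (card {S \<in> connection_sets p. dihedral_affine p 1 0 ` S = S}) = 2 ^ m * (2 ^ p - 1) - int p"
proof -
  have "fixed_residues 1 0 = {0..<int p}" by auto
  then have "card (fixed_residues 1 0) = p" by simp
  then show ?thesis
    using card_fixed_connection_sets[of 1 0] card_rot_sets[of 0] card_refl_sets_id by simp
qed

text \<open>A nonempty invariant reflection half must be full and no residue is fixed, so only the
  \<open>2 ^ m\<close> choices of the rotation half remain.\<close>

lemma card_fixed_translation:
  assumes v: "\<not> int p dvd v"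
  shows "int (card {S \<in> connection_sets p. dihedral_affine p 1 v ` S = S}) = 2 ^ m"
proof -
  have "b \<notin> fixed_residues 1 v" for b
  proof
    assume "b \<in> fixed_residues 1 v"
    then have "(b + v) mod int p = b mod int p" by simp
    then show False using v by (simp add: mod_eq_dvd_iff)
  qed
  then have "fixed_residues 1 v = {}" by blast
  then have "card (fixed_residues 1 v) = 0" by (simp only: card.empty)
  then show ?thesis
    using card_fixed_connection_sets[of 1 v] card_rot_sets[of 0] card_refl_sets_translation[OF v] by simp
qed

text \<open>The parameters are read off from the images of \<open>(1, False)\<close> and
  \<open>(0, True)\<close>; \<open>i\<close> is the logarithm of the slope.\<close>

lemma bij_betw_auto:
  "bij_betw (\<lambda>(i, v). dihedral_affine p (int g ^ i) (int v)) ({..<p - 1} \<times> {..<p})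
    (auto (dihedral_group p))"
  unfolding bij_betw_def
proof
  let ?F = "\<lambda>(i, v). dihedral_affine p (int g ^ i) (int v)"
  have V: "(b, t) \<in> carrier (dihedral_group p) \<longleftrightarrow> b \<in> {0..<int p}" for b t
    by (simp add: carrier_dihedral_group)
  show "inj_on ?F ({..<p - 1} \<times> {..<p})"
  proof (rule inj_onI, clarsimp)
    fix i v j w assume ij: "i < p - Suc 0" "j < p - Suc 0" and vw: "v < p" "w < p"
      and eq: "dihedral_affine p (int g ^ i) (int v) = dihedral_affine p (int g ^ j) (int w)"
    have "pw i = pw j"
      using arg_cong[OF eq, of "\<lambda>f. f (1, False)"] p_gt by (simp add: dihedral_affine_apply V pw_def)
    then have "i = j" using ij by (simp add: pw_eq_iff)
    moreover have "int v mod int p = int w mod int p"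
      using arg_cong[OF eq, of "\<lambda>f. f (0, True)"] p_gt by (simp add: dihedral_affine_apply V)
    then have "v = w" using vw by simp
    ultimately show "i = j \<and> v = w" by simp
  qed
  show "?F ` ({..<p - 1} \<times> {..<p}) = auto (dihedral_group p)"
  proof (intro equalityI subsetI)
    fix f assume "f \<in> ?F ` ({..<p - 1} \<times> {..<p})"
    then show "f \<in> auto (dihedral_group p)"
      using auto_dihedral_group[OF p_gt] coprime_root_pow by auto
  next
    fix f assume "f \<in> auto (dihedral_group p)"
    then obtain u v where u: "coprime u (int p)" and f: "f = dihedral_affine p u v"
      using auto_dihedral_group[OF p_gt] by auto
    have "u mod int p \<noteq> 0" using u p_coprime_iff by (simp add: dvd_eq_mod_eq_0)
    moreover have "0 \<le> u mod int p" "u mod int p < int p" using p_gt by simp_all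
    ultimately have "u mod int p \<in> {1..<int p}" by simp
    then obtain i where i: "i < p - 1" "pw i = u mod int p" by (rule pw_surj)
    define w where "w = nat (v mod int p)"
    have w: "int w = v mod int p" "w < p" using p_gt by (simp_all add: w_def nat_less_iff)
    have eq: "(u * a + (if s then v else 0)) mod int p
        = (int g ^ i * a + (if s then int w else 0)) mod int p" for a s
    proof -
      have red: "(x mod int p * a + c) mod int p = (x * a + c) mod int p" for x c
        using mod_affine_mod[of a x "int p" c] by (simp add: mult.commute)
      have "(u * a + (if s then v else 0)) mod int p
          = ((u mod int p) * a + (if s then v mod int p else 0)) mod int p"
        by (cases s) (simp_all add: red mod_simps)
      also have "\<dots> = (int g ^ i * a + (if s then int w else 0)) mod int p"
        unfolding i(2)[symmetric] w(1)[symmetric] pw_def by (rule red)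
      finally show ?thesis .
    qed
    have "f = dihedral_affine p (int g ^ i) (int w)"
      unfolding f dihedral_affine_def by (rule restrict_ext) (simp only: case_prod_unfold eq)
    then show "f \<in> ?F ` ({..<p - 1} \<times> {..<p})" using i(1) w(2) by (intro image_eqI[of _ _ "(i, w)"]) auto
  qed
qed

text \<open>The contributions are those of the identity, of the \<open>p - 1\<close> nonzero
  translations, and of the \<open>p\<close> maps for each slope \<open>g ^ i\<close> other than
  1.\<close>

lemma burnside_count:
  "int (num_up_to_iso (connected_cayley_graphs (dihedral_group p))) * (int p * (int p - 1)) =
    2 ^ m * (2 ^ p - 1) - int p + (int p - 1) * 2 ^ m
    + int p * (\<Sum>i\<in>{1..<p - 1}. 2 ^ gcd i m * (2 * 2 ^ gcd i (p - 1) - 1) - 1)"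
proof -
  let ?D = "dihedral_group p" and ?X = "connection_sets p"
  let ?F = "\<lambda>(i, v). dihedral_affine p (int g ^ i) (int v)"
  let ?c = "\<lambda>f. card {S \<in> ?X. f ` S = S}"
  let ?I = "{..<p - 1} \<times> {..<p}"
  interpret A: group_action "AutoGroup ?D" ?X "image_action ?X"
    by (rule group_action_connection_sets[OF p])
  have carr: "carrier (AutoGroup ?D) = auto ?D" by (simp add: AutoGroup_def)
  have fin: "finite (auto ?D)" using bij_betw_finite[OF bij_betw_auto] by simp
  have "?X \<subseteq> Pow (carrier ?D)" by (auto simp: connection_sets_def cayley_set_def)
  then have finX: "finite ?X" by (rule finite_subset) (simp add: carrier_dihedral_group)
  have ord: "order (AutoGroup ?D) = (p - 1) * p"
    using bij_betw_same_card[OF bij_betw_auto] by (simp add: order_def carr card_cartesian_product)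
  have inv: "invariants ?X (image_action ?X) f = {S \<in> ?X. f ` S = S}" for f
    by (auto simp: invariants_def)
  have "card (orbits (AutoGroup ?D) ?X (image_action ?X)) * ((p - 1) * p) = (\<Sum>f\<in>auto ?D. ?c f)"
    using A.burnside finX fin unfolding carr ord inv by blast
  also have "\<dots> = (\<Sum>x\<in>?I. ?c (?F x))"
    by (rule sum.reindex_bij_betw[OF bij_betw_auto, symmetric])
  also have "\<dots> = (\<Sum>i<p - 1. \<Sum>v<p. ?c (dihedral_affine p (int g ^ i) (int v)))"
    by (simp add: sum.cartesian_product case_prod_unfold)
  finally have "int (num_up_to_iso (connected_cayley_graphs ?D) * ((p - 1) * p)) =
      (\<Sum>i<p - 1. \<Sum>v<p. int (?c (dihedral_affine p (int g ^ i) (int v))))"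
    unfolding num_connected_cayley_graphs_eq_card_orbits[OF p] by simp
  also have "{..<p - 1} = insert 0 {1..<p - 1}" using p_gt by auto
  also have "(\<Sum>i\<in>insert 0 {1..<p - 1}. \<Sum>v<p. int (?c (dihedral_affine p (int g ^ i) (int v)))) =
      (\<Sum>v<p. int (?c (dihedral_affine p 1 (int v)))) +
      (\<Sum>i\<in>{1..<p - 1}. \<Sum>v<p. int (?c (dihedral_affine p (int g ^ i) (int v))))"
    by simp
  also have "(\<Sum>i\<in>{1..<p - 1}. \<Sum>v<p. int (?c (dihedral_affine p (int g ^ i) (int v)))) =
      int p * (\<Sum>i\<in>{1..<p - 1}. 2 ^ gcd i m * (2 * 2 ^ gcd i (p - 1) - 1) - 1)"
    unfolding sum_distrib_left by (rule sum.cong[OF refl], subst sum.cong[OF refl card_fixed_general]) simp_all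
  also have "(\<Sum>v<p. int (?c (dihedral_affine p 1 (int v)))) =
      2 ^ m * (2 ^ p - 1) - int p + (int p - 1) * 2 ^ m"
  proof -
    have "{..<p} = insert 0 {1..<p}" using p_gt by auto
    then have "(\<Sum>v<p. int (?c (dihedral_affine p 1 (int v)))) =
        int (?c (dihedral_affine p 1 0)) + (\<Sum>v\<in>{1..<p}. int (?c (dihedral_affine p 1 (int v))))"
      by simp
    also have "(\<Sum>v\<in>{1..<p}. int (?c (dihedral_affine p 1 (int v)))) = (\<Sum>v\<in>{1..<p}. 2 ^ m)"
    proof (rule sum.cong[OF refl])
      fix v assume "v \<in> {1..<p}"
      then have "\<not> int p dvd int v" by (auto dest: dvd_imp_le)
      then show "int (?c (dihedral_affine p 1 (int v))) = 2 ^ m" by (rule card_fixed_translation)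
    qed
    finally show ?thesis using p_gt by (simp add: card_fixed_id of_nat_diff)
  qed
  finally show ?thesis using p_gt by (simp add: of_nat_diff mult.commute)
qed

end

theorem theorem4p5:
  fixes p :: nat and N' Nc' :: real
  assumes "prime p" and "odd p"
  defines "N' \<equiv>
      1 / real p * (2 ^ ((p + 1) div 2) - 2 ^ ((3 * p - 1) div 2))
      + 2 / (real p - 1) *
        (\<Sum>i = 0..p - 2. 2 ^ (gcd (2 * i) (p - 1) div 2 + gcd i (p - 1)))"
    and "Nc' \<equiv>
      2 / (real p - 1) *
        (\<Sum>d | d dvd (p - 1) div 2. real (totient d) * 2 ^ ((p - 1) div (2 * d)))"
  shows "real (num_up_to_iso (connected_cayley_graphs (dihedral_group p))) = N' - Nc' - 1"
proof -
  obtain g where "residue_primroot p g" using prime_primitive_root_exists[OF prime_gt_1_nat[OF assms(1)] assms(1)] by blast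
  then interpret odd_prime_root p g using assms(1,2) by unfold_locales
  define a :: "nat \<Rightarrow> real" where "a i = 2 ^ gcd i m" for i
  define b :: "nat \<Rightarrow> real" where "b i = 2 ^ gcd i (p - 1)" for i
  \<comment> \<open>\<open>s\<close> and \<open>t\<close> include \<open>i = 0\<close>, as the
    stated formula does, whereas the Burnside sum starts at 1.\<close>
  define s where "s = (\<Sum>i<p - 1. a i * b i)"
  define t where "t = (\<Sum>i<p - 1. a i)"
  define P where "P = real p"
  let ?N = "real (num_up_to_iso (connected_cayley_graphs (dihedral_group p)))"
  have p2: "p = 2 * m + 1" using two_m p_gt by simp
  have P: "P > 2" using p_gt by (simp add: P_def)
  have a0: "a 0 = 2 ^ m" and b0: "b 0 = 2 ^ (p - 1)" by (simp_all add: a_def b_def)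
  have dbl: "2 * 2 ^ (p - 1) = (2::real) ^ p" using p_gt by (simp flip: power_Suc)
  have split: "{..<p - 1} = insert 0 {1..<p - 1}" using p_gt by auto
  have "(\<Sum>i = 0..p - 2. 2 ^ (gcd (2 * i) (p - 1) div 2 + gcd i (p - 1))) = s"
  proof -
    have "{0..p - 2} = {..<p - 1}" using p_gt by auto
    moreover have "gcd (2 * i) (p - 1) div 2 = gcd i m" for i
      unfolding two_m by (simp flip: gcd_mult_distrib_nat)
    ultimately show ?thesis by (simp add: s_def a_def b_def power_add)
  qed
  moreover have "(p + 1) div 2 = m + 1" "(3 * p - 1) div 2 = m + p" using p2 by simp_all
  ultimately have N': "N' = (2 * 2 ^ m - 2 ^ m * 2 ^ p) / P + 2 * s / (P - 1)"
    unfolding N'_def by (simp add: P_def power_add)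
  \<comment> \<open>\<open>gcd i m\<close> has period \<open>m\<close> in \<open>i\<close>, and the
    range \<open>p - 1\<close> covers two periods; this is the factor 2 in
    \<open>Nc'\<close>.\<close>
  have "t = 2 * (\<Sum>i<m. a i)"
  proof -
    have "t = sum a {0..<m} + sum a {m..<m + m}"
      unfolding t_def two_m mult_2 lessThan_atLeast0 by (rule sum.atLeastLessThan_concat[symmetric]) simp_all
    also have "sum a {m..<m + m} = sum a {0..<m}"
      using sum.shift_bounds_nat_ivl[of a 0 m m] by (simp add: a_def)
    also have "sum a {0..<m} = (\<Sum>i<m. a i)" by (simp add: lessThan_atLeast0)
    finally show ?thesis by simp
  qed
  also have "(\<Sum>i<m. a i) = (\<Sum>d | d dvd m. real (totient d) * 2 ^ (m div d))"
    using sum_gcd_eq_sum_divisors[OF m_pos, of "\<lambda>k. 2 ^ k"] by (simp add: a_def)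
  finally have "t = 2 * (\<Sum>d | d dvd m. real (totient d) * 2 ^ (m div d))" .
  moreover have "(p - 1) div (2 * d) = m div d" for d unfolding two_m by simp
  ultimately have Nc': "Nc' = t / (P - 1)"
    unfolding Nc'_def by (simp add: P_def m_def)
  have "?N * (P * (P - 1)) = real_of_int (int (num_up_to_iso (connected_cayley_graphs (dihedral_group p)))
      * (int p * (int p - 1)))"
    by (simp add: P_def)
  also have "\<dots> = 2 ^ m * (2 ^ p - 1) - P + (P - 1) * 2 ^ m
      + P * (\<Sum>i\<in>{1..<p - 1}. a i * (2 * b i - 1) - 1)"
    unfolding burnside_count by (simp add: P_def a_def b_def)
  \<comment> \<open>There are \<open>p - 2\<close> indices, whence \<open>P - 2\<close>. The sum of
    the \<open>a i\<close> leads to \<open>Nc'\<close>, and the constant contributes to the final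
    1.\<close>
  also have "(\<Sum>i\<in>{1..<p - 1}. a i * (2 * b i - 1) - 1) =
      2 * (\<Sum>i\<in>{1..<p - 1}. a i * b i) - (\<Sum>i\<in>{1..<p - 1}. a i) - (P - 2)"
    using p_gt by (simp add: sum_subtractf sum_distrib_left right_diff_distrib of_nat_diff P_def mult_ac)
  also have "(\<Sum>i\<in>{1..<p - 1}. a i * b i) = s - 2 ^ m * 2 ^ (p - 1)"
    unfolding s_def split by (simp add: a0 b0)
  also have "(\<Sum>i\<in>{1..<p - 1}. a i) = t - 2 ^ m"
    unfolding t_def split by (simp add: a0)
  also have "2 * (s - 2 ^ m * 2 ^ (p - 1)) = 2 * s - 2 ^ m * 2 ^ p"
    unfolding dbl[symmetric] by (simp add: algebra_simps)
  finally have count: "?N * (P * (P - 1)) = 2 ^ m * (2 ^ p - 1) - P + (P - 1) * 2 ^ m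
      + P * (2 * s - 2 ^ m * 2 ^ p - (t - 2 ^ m) - (P - 2))" .
  have e1: "x / P * (P * (P - 1)) = x * (P - 1)" and e2: "x / (P - 1) * (P * (P - 1)) = x * P" for x
    using P by simp_all
  have "(N' - Nc' - 1) * (P * (P - 1)) =
      (2 * 2 ^ m - 2 ^ m * 2 ^ p) * (P - 1) + 2 * s * P - t * P - P * (P - 1)"
    unfolding N' Nc' by (simp only: left_diff_distrib distrib_right e1 e2 mult_1)
  also have "\<dots> = ?N * (P * (P - 1))" unfolding count by (simp add: algebra_simps)
  finally show ?thesis using P by simp
qed

end
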